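(* Let $\omega\in\mathbb{C}$, $\omega\neq0$, $n\ge1$, and let $\varphi:U_q(h)^{\otimes n}\to BU_q(h)^{\underline\otimes n}$ be the algebra isomorphism given by $A_i^\dagger\mapsto\bar X_i^\dagger$, $A_i\mapsto\bar X_i$, $H_i\mapsto\bar H_i$, $N_i\mapsto\bar M_i$. Transport the action of the primitive generator $N\in U_q(h)$ on $BU_q(h)^{\underline\otimes n}$ to $U_q(h)^{\otimes n}$ along $\varphi$, i.e. $h\rhd Y:=\varphi^{-1}(h\rhd\varphi(Y))$. Then for all $t\in\mathbb{R}$ and all $i$ $$e^{itN}\rhd A_i^\dagger=e^{it}A_i^\dagger,\qquad e^{itN}\rhd A_i=e^{-it}A_i,\qquad e^{itN}\rhd H_i=H_i,\qquad e^{itN}\rhd N_i=N_i,$$ where in the exponent $i=\sqrt{-1}$, and this is the time evolution generated by the free Hamiltonian $\mathcal{H}=\sum_{i=1}^nN_i$: one has $N\rhd Y=[\mathcal{H},Y]$ for all $Y\in U_q(h)^{\otimes n}$.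
   Context: Convention on exponentials: central elements $H_i$ (resp. $\bar H_i$) come together with central invertible elements $e^{\omega H_i/4}$ (resp. $e^{\omega\bar H_i/4}$); other exponentials are products of integer powers of these. $[H]=\frac1\omega(e^{\omega H/2}-e^{-\omega H/2})$. **$U_q(h)^{\otimes n}$**: unital algebra generated by $A_i,A_i^\dagger,N_i,H_i$ and $e^{\pm\omega H_i/4}$ ($1\le i\le n$) with $H_i$, $e^{\pm\omega H_i/4}$ central and $[A_i,A_j]=0=[A_i^\dagger,A_j^\dagger]$, $[A_i,A_j^\dagger]=\delta_{ij}[H_i]$, $[N_i,A_j]=-\delta_{ij}A_i$, $[N_i,A_j^\dagger]=\delta_{ij}A_i^\dagger$, $[N_i,N_j]=0$. **$BU_q(h)^{\underline\otimes n}$** ($n$-fold braided tensor product): unital algebra generated by $\bar A_i,\bar A_i^\dagger,\bar N_i,\bar H_i$, $e^{\pm\omega\bar H_i/4}$, with $\bar H_i$, $e^{\pm\omega\bar H_i/4}$ central and - $[\bar A_i,\bar A_j]=0$, $[\bar A_i^\dagger,\bar A_j^\dagger]=0$ for all $i,j$; - $[\bar A_i,\bar A_j^\dagger]=\omega e^{-\omega\bar H_i/4}[\bar H_i]e^{-\omega\bar H_j/4}[\bar H_j]$ if $i<j$; $=[\bar H_i]$ if $i=j$; $=0$ if $i>j$; - $[\bar N_i,\bar A_j]=0$ if $i<j$; $=-\bar A_i$ if $i=j$; $=-\omega e^{-\omega\bar H_j/4}[\bar H_j]e^{-\omega\bar H_i/4}\bar A_i$ if $i>j$; - $[\bar N_i,\bar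 A_j^\dagger]=\omega e^{-\omega\bar H_i/4}\bar A_i^\dagger e^{-\omega\bar H_j/4}[\bar H_j]$ if $i<j$; $=\bar A_i^\dagger$ if $i=j$; $=0$ if $i>j$; - $[\bar N_i,\bar N_j]=\omega e^{-\omega\bar H_i/4}\bar A_i^\dagger e^{-\omega\bar H_j/4}\bar A_j$ if $i<j$. **"Diagonalised" generators of $BU_q(h)^{\underline\otimes n}$:** $$\bar X_i=e^{-\frac\omega2(\bar H_1+\cdots+\bar H_{i-1})}\bar A_i,$$ $$\bar X_i^\dagger=e^{\frac\omega2(\bar H_1+\cdots+\bar H_{i-1})}\bar A_i^\dagger-\omega[\bar H_i]e^{-\frac\omega4\bar H_i}\sum_{j=1}^{i-1}e^{\frac\omega2(\bar H_1+\cdots+\bar H_{j-1})}e^{\frac\omega4\bar H_j}e^{-\frac\omega2(\bar H_{j+1}+\cdots+\bar H_{i-1})}\bar A_j^\dagger,$$ $$\bar M_i=\bar N_i-\omega e^{-\frac\omega4\bar H_i}\sum_{j=1}^{i-1}e^{-\frac\omega4\bar H_j}e^{-\omega(\bar H_{j+1}+\cdots+\bar H_{i-1})}\bar A_j^\dagger\bar A_i .$$ **Action of $N$.** $U_q(h)$ acts on $BU_q(h)$ by the quantum adjoint action, and on the braided tensor product through its coproduct. Since $N$ is primitive in $U_q(h)$ ($\Delta N=N\otimes1+1\otimes N$), it acts on $BU_q(h)^{\underline\otimes n}$ as the derivation with $N\rhd\bar A_i^\dagger=\bar A_i^\dagger$, $N\rhd\bar A_i=-\bar A_i$, $N\rhd\bar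 N_i=0$, $N\rhd\bar H_i=0$ (and zero on exponentials of $\bar H_i$); $e^{itN}\rhd$ denotes the exponential of this derivation (an algebra automorphism multiplying a product of weight $w$ by $e^{itw}$). *)

theory Defs
  imports
    "HOL-Analysis.Analysis"
    "HOL-Library.Poly_Mapping"
    "HOL-Algebra.QuotRing"
    "HOL-Algebra.Module"
begin

section \<open>Complex algebras given by generators and relations\<close>

text \<open>The free monoid, written additively so that \<open>'x word \<Rightarrow>\<^sub>0 complex\<close> with its library
  (convolution) multiplication is the algebra of noncommutative polynomials over the complex
  numbers.\<close>

datatype 'x word = Word (letters: "'x list")

instantiation word :: (type) monoid_add
begin
definition zero_word :: "'a word" where "0 = Word []"
definition plus_word :: "'a word \<Rightarrow> 'a word \<Rightarrow> 'a word" where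
  "v + w = Word (letters v @ letters w)"
instance by standard (simp_all add: zero_word_def plus_word_def)
end

type_synonym 'x ncpoly = "'x word \<Rightarrow>\<^sub>0 complex"

definition var :: "'x \<Rightarrow> 'x ncpoly" where
  "var x = Poly_Mapping.single (Word [x]) 1"

definition const :: "complex \<Rightarrow> 'x ncpoly" where
  "const c = Poly_Mapping.single 0 c"

definition free_alg :: "'x set \<Rightarrow> 'x ncpoly ring" where
  "free_alg S = \<lparr>carrier = {p. \<forall>w \<in> Poly_Mapping.keys p. set (letters w) \<subseteq> S},
     mult = (*), one = 1, zero = 0, add = (+)\<rparr>"

text \<open>\<open>cls S R p\<close> is the element represented by \<open>p\<close> in the algebra with generators \<open>S\<close> and
  relations \<open>r = 0\<close> for \<open>r \<in> R\<close>.\<close>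

definition cls :: "'x set \<Rightarrow> 'x ncpoly set \<Rightarrow> 'x ncpoly \<Rightarrow> 'x ncpoly set" where
  "cls S R p = (Idl\<^bsub>free_alg S\<^esub> R) +>\<^bsub>free_alg S\<^esub> p"

definition presented_alg ::
    "'x set \<Rightarrow> 'x ncpoly set \<Rightarrow> (complex, 'x ncpoly set) module" where
  "presented_alg S R = (let Q = free_alg S Quot (Idl\<^bsub>free_alg S\<^esub> R) in
     \<lparr>carrier = carrier Q, mult = mult Q, one = one Q, zero = zero Q, add = add Q,
      smult = (\<lambda>c x. cls S R (const c) \<otimes>\<^bsub>Q\<^esub> x)\<rparr>)"

definition alg_iso :: "(complex, 'a) module \<Rightarrow> (complex, 'b) module \<Rightarrow> ('a \<Rightarrow> 'b) \<Rightarrow> bool" where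
  "alg_iso A B f \<longleftrightarrow> f \<in> ring_hom A B \<and> bij_betw f (carrier A) (carrier B) \<and>
     (\<forall>c. \<forall>x \<in> carrier A. f (c \<odot>\<^bsub>A\<^esub> x) = c \<odot>\<^bsub>B\<^esub> f x)"

definition derivation :: "(complex, 'a) module \<Rightarrow> ('a \<Rightarrow> 'a) \<Rightarrow> bool" where
  "derivation A D \<longleftrightarrow> D \<in> carrier A \<rightarrow> carrier A \<and>
     (\<forall>x \<in> carrier A. \<forall>y \<in> carrier A. D (x \<oplus>\<^bsub>A\<^esub> y) = D x \<oplus>\<^bsub>A\<^esub> D y) \<and>
     (\<forall>c. \<forall>x \<in> carrier A. D (c \<odot>\<^bsub>A\<^esub> x) = c \<odot>\<^bsub>A\<^esub> D x) \<and>
     (\<forall>x \<in> carrier A. \<forall>y \<in> carrier A.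
        D (x \<otimes>\<^bsub>A\<^esub> y) = (D x \<otimes>\<^bsub>A\<^esub> y) \<oplus>\<^bsub>A\<^esub> (x \<otimes>\<^bsub>A\<^esub> D y))"

definition linear_functional :: "(complex, 'a) module \<Rightarrow> ('a \<Rightarrow> complex) \<Rightarrow> bool" where
  "linear_functional A f \<longleftrightarrow>
     (\<forall>x \<in> carrier A. \<forall>y \<in> carrier A. f (x \<oplus>\<^bsub>A\<^esub> y) = f x + f y) \<and>
     (\<forall>c. \<forall>x \<in> carrier A. f (c \<odot>\<^bsub>A\<^esub> x) = c * f x)"

text \<open>The exponential series \<open>\<Sum>k. T\<^sup>k y / k!\<close> of a linear operator \<open>T\<close>. The algebra carries no
  topology, so the series is summed weakly: against every linear functional. Functionals separate
  points, hence the sum is unique; it exists whenever \<open>y\<close> lies in a finite-dimensional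
  \<open>T\<close>-invariant subspace, and is then the usual operator exponential.\<close>

definition op_exp :: "(complex, 'a) module \<Rightarrow> ('a \<Rightarrow> 'a) \<Rightarrow> 'a \<Rightarrow> 'a" where
  "op_exp A T y = (THE z. z \<in> carrier A \<and>
     (\<forall>f. linear_functional A f \<longrightarrow> (\<lambda>k. f ((T ^^ k) y) / fact k) sums f z))"

definition transport ::
    "(complex, 'a) module \<Rightarrow> ('a \<Rightarrow> 'b) \<Rightarrow> ('b \<Rightarrow> 'b) \<Rightarrow> 'a \<Rightarrow> 'a" where
  "transport A f T y = inv_into (carrier A) f (T (f y))"


section \<open>The two algebras\<close>

text \<open>Generators \<open>A\<^sub>i\<close>, \<open>A\<^sub>i\<^sup>\<dagger>\<close>, \<open>N\<^sub>i\<close>, \<open>H\<^sub>i\<close> and the exponentials of \<open>\<omega>H\<^sub>i/4\<close> and \<open>-\<omega>H\<^sub>i/4\<close>. The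
  same names serve for the barred generators of the braided algebra.\<close>

datatype gen = A_gen nat | Ad_gen nat | N_gen nat | H_gen nat | Exp_gen nat | Expinv_gen nat

definition gens :: "nat \<Rightarrow> gen set" where
  "gens n = (\<Union>i \<in> {1..n}. {A_gen i, Ad_gen i, N_gen i, H_gen i, Exp_gen i, Expinv_gen i})"

abbreviation gA :: "nat \<Rightarrow> gen ncpoly" where "gA i \<equiv> var (A_gen i)"
abbreviation gAd :: "nat \<Rightarrow> gen ncpoly" where "gAd i \<equiv> var (Ad_gen i)"
abbreviation gN :: "nat \<Rightarrow> gen ncpoly" where "gN i \<equiv> var (N_gen i)"
abbreviation gH :: "nat \<Rightarrow> gen ncpoly" where "gH i \<equiv> var (H_gen i)"
abbreviation gE :: "nat \<Rightarrow> gen ncpoly" where "gE i \<equiv> var (Exp_gen i)"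
abbreviation gEi :: "nat \<Rightarrow> gen ncpoly" where "gEi i \<equiv> var (Expinv_gen i)"

definition comm :: "'a::ring \<Rightarrow> 'a \<Rightarrow> 'a" where
  "comm x y = x * y - y * x"

text \<open>\<open>ex m i\<close> is the exponential of \<open>m\<omega>H\<^sub>i/4\<close>, \<open>exs m a b\<close> that of \<open>m\<omega>(H\<^sub>a + \<dots> + H\<^sub>b\<^sub>-\<^sub>1)/4\<close>, and
  \<open>qH \<omega> i\<close> is \<open>[H\<^sub>i]\<close>.\<close>

definition ex :: "int \<Rightarrow> nat \<Rightarrow> gen ncpoly" where
  "ex m i = (if m \<ge> 0 then gE i ^ nat m else gEi i ^ nat (- m))"

definition exs :: "int \<Rightarrow> nat \<Rightarrow> nat \<Rightarrow> gen ncpoly" where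
  "exs m a b = prod_list (map (ex m) [a..<b])"

definition qH :: "complex \<Rightarrow> nat \<Rightarrow> gen ncpoly" where
  "qH \<omega> i = const (1 / \<omega>) * (ex 2 i - ex (- 2) i)"

definition central_rels :: "nat \<Rightarrow> gen ncpoly set" where
  "central_rels n =
     {comm (var z) (var x) | z x i. i \<in> {1..n} \<and> z \<in> {H_gen i, Exp_gen i, Expinv_gen i} \<and>
        x \<in> gens n} \<union>
     {gE i * gEi i - 1 | i. i \<in> {1..n}} \<union> {gEi i * gE i - 1 | i. i \<in> {1..n}}"

definition U_rels :: "complex \<Rightarrow> nat \<Rightarrow> gen ncpoly set" where
  "U_rels \<omega> n = central_rels n \<union>
     (\<Union>i \<in> {1..n}. \<Union>j \<in> {1..n}.
       {comm (gA i) (gA j),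
        comm (gAd i) (gAd j),
        comm (gA i) (gAd j) - (if i = j then qH \<omega> i else 0),
        comm (gN i) (gA j) + (if i = j then gA i else 0),
        comm (gN i) (gAd j) - (if i = j then gAd i else 0),
        comm (gN i) (gN j)})"

definition BU_rels :: "complex \<Rightarrow> nat \<Rightarrow> gen ncpoly set" where
  "BU_rels \<omega> n = central_rels n \<union>
     (\<Union>i \<in> {1..n}. \<Union>j \<in> {1..n}.
       {comm (gA i) (gA j),
        comm (gAd i) (gAd j),
        comm (gA i) (gAd j) -
          (if i < j then const \<omega> * ex (- 1) i * qH \<omega> i * ex (- 1) j * qH \<omega> j
           else if i = j then qH \<omega> i else 0),
        comm (gN i) (gA j) -
          (if i < j then 0 else if i = j then - gA i
           else - (const \<omega> * ex (- 1) j * qH \<omega> j * ex (- 1) i * gA i)),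
        comm (gN i) (gAd j) -
          (if i < j then const \<omega> * ex (- 1) i * gAd i * ex (- 1) j * qH \<omega> j
           else if i = j then gAd i else 0)}) \<union>
     {comm (gN i) (gN j) - const \<omega> * ex (- 1) i * gAd i * ex (- 1) j * gA j | i j.
        i \<in> {1..n} \<and> j \<in> {1..n} \<and> i < j}"

definition U_alg :: "complex \<Rightarrow> nat \<Rightarrow> (complex, gen ncpoly set) module" where
  "U_alg \<omega> n = presented_alg (gens n) (U_rels \<omega> n)"

definition BU_alg :: "complex \<Rightarrow> nat \<Rightarrow> (complex, gen ncpoly set) module" where
  "BU_alg \<omega> n = presented_alg (gens n) (BU_rels \<omega> n)"

definition U_cls :: "complex \<Rightarrow> nat \<Rightarrow> gen ncpoly \<Rightarrow> gen ncpoly set" where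
  "U_cls \<omega> n = cls (gens n) (U_rels \<omega> n)"

definition BU_cls :: "complex \<Rightarrow> nat \<Rightarrow> gen ncpoly \<Rightarrow> gen ncpoly set" where
  "BU_cls \<omega> n = cls (gens n) (BU_rels \<omega> n)"


section \<open>Diagonalised generators of the braided algebra\<close>

definition X :: "nat \<Rightarrow> gen ncpoly" where
  "X i = exs (- 2) 1 i * gA i"

definition Xd :: "complex \<Rightarrow> nat \<Rightarrow> gen ncpoly" where
  "Xd \<omega> i = exs 2 1 i * gAd i - const \<omega> * qH \<omega> i * ex (- 1) i *
     (\<Sum>j \<in> {1..<i}. exs 2 1 j * ex 1 j * exs (- 2) (j + 1) i * gAd j)"

definition M :: "complex \<Rightarrow> nat \<Rightarrow> gen ncpoly" where
  "M \<omega> i = gN i - const \<omega> * ex (- 1) i *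
     (\<Sum>j \<in> {1..<i}. ex (- 1) j * exs (- 4) (j + 1) i * gAd j * gA i)"


section \<open>The action of the primitive generator and the free Hamiltonian\<close>

text \<open>The derivation \<open>N \<rhd> _\<close> of the braided algebra; it is determined on the carrier by its values on
  generators, and \<open>extensional\<close> fixes the irrelevant values elsewhere.\<close>

definition N_act :: "complex \<Rightarrow> nat \<Rightarrow> gen ncpoly set \<Rightarrow> gen ncpoly set" where
  "N_act \<omega> n = (THE D. D \<in> extensional (carrier (BU_alg \<omega> n)) \<and> derivation (BU_alg \<omega> n) D \<and>
     (\<forall>i \<in> {1..n}.
        D (BU_cls \<omega> n (gAd i)) = BU_cls \<omega> n (gAd i) \<and>
        D (BU_cls \<omega> n (gA i)) = \<ominus>\<^bsub>BU_alg \<omega> n\<^esub> BU_cls \<omega> n (gA i) \<and>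
        D (BU_cls \<omega> n (gN i)) = \<zero>\<^bsub>BU_alg \<omega> n\<^esub> \<and>
        D (BU_cls \<omega> n (gH i)) = \<zero>\<^bsub>BU_alg \<omega> n\<^esub> \<and>
        D (BU_cls \<omega> n (gE i)) = \<zero>\<^bsub>BU_alg \<omega> n\<^esub> \<and>
        D (BU_cls \<omega> n (gEi i)) = \<zero>\<^bsub>BU_alg \<omega> n\<^esub>))"

definition exp_N_act :: "complex \<Rightarrow> nat \<Rightarrow> real \<Rightarrow> gen ncpoly set \<Rightarrow> gen ncpoly set" where
  "exp_N_act \<omega> n t =
     op_exp (BU_alg \<omega> n) (\<lambda>y. (\<i> * of_real t) \<odot>\<^bsub>BU_alg \<omega> n\<^esub> N_act \<omega> n y)"

definition Ham :: "complex \<Rightarrow> nat \<Rightarrow> gen ncpoly set" where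
  "Ham \<omega> n = (\<Oplus>\<^bsub>U_alg \<omega> n\<^esub> i \<in> {1..n}. U_cls \<omega> n (gN i))"

definition ad_Ham :: "complex \<Rightarrow> nat \<Rightarrow> gen ncpoly set \<Rightarrow> gen ncpoly set" where
  "ad_Ham \<omega> n y = (Ham \<omega> n \<otimes>\<^bsub>U_alg \<omega> n\<^esub> y) \<ominus>\<^bsub>U_alg \<omega> n\<^esub> (y \<otimes>\<^bsub>U_alg \<omega> n\<^esub> Ham \<omega> n)"

end

(* Giving A-dagger, A and all other generators the weights 1, -1 and 0 makes every relation of the
   braided algebra homogeneous, so N acts as the Euler derivation of the resulting grading: it
   multiplies an element of weight d by d, and its exponential multiplies it by exp (i t d). The
   diagonalised generators have the same weights as the generators they replace. In the unbraided
   algebra the commutator with the sum of the N_i is also a derivation, and it takes the same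
   values on generators. *)

theory Submission
  imports Defs
begin

section \<open>Presented algebras\<close>

text \<open>The action and its exponential are both definite descriptions, so each needs existence
  and uniqueness. For the action, existence means that the weight operator on polynomials descends
  to the quotient, and uniqueness that a derivation is fixed by its values on generators. For the
  exponential there is no topology to work with: existence is convergence under every linear
  functional, which reduces to finitely many scalar exponential series because a polynomial has
  finitely many words; uniqueness is the fact that linear functionals separate the points of a
  quotient. The exponential of the commutator with the Hamiltonian is not computed inside the
  unbraided algebra: its convergence is pulled back along \<phi>, which intertwines the two
  derivations.\<close>

lemma free_alg_simps [simp]:
  "mult (free_alg S) = (*)" "one (free_alg S) = 1" "zero (free_alg S) = 0" "add (free_alg S) = (+)"
  by (simp_all add: free_alg_def)

lemma in_free_alg_iff:
  "p \<in> carrier (free_alg S) \<longleftrightarrow> (\<forall>w. Poly_Mapping.lookup p w \<noteq> 0 \<longrightarrow> set (letters w) \<subseteq> S)"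
  by (auto simp: free_alg_def in_keys_iff)

lemma free_alg_add [intro]:
  "p \<in> carrier (free_alg S) \<Longrightarrow> q \<in> carrier (free_alg S) \<Longrightarrow> p + q \<in> carrier (free_alg S)"
  by (auto simp: in_free_alg_iff lookup_add) (metis add.right_neutral subsetD)

lemma free_alg_uminus [intro]: "p \<in> carrier (free_alg S) \<Longrightarrow> - p \<in> carrier (free_alg S)"
  by (simp add: in_free_alg_iff)

lemma free_alg_diff [intro]:
  "p \<in> carrier (free_alg S) \<Longrightarrow> q \<in> carrier (free_alg S) \<Longrightarrow> p - q \<in> carrier (free_alg S)"
  using free_alg_add [of p S "- q"] by (simp add: free_alg_uminus)

lemma free_alg_mult [intro]:
  assumes "p \<in> carrier (free_alg S)" "q \<in> carrier (free_alg S)"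
  shows "p * q \<in> carrier (free_alg S)"
  unfolding free_alg_def
proof clarsimp
  fix w x assume w: "w \<in> Poly_Mapping.keys (p * q)" and x: "x \<in> set (letters w)"
  obtain u v where "w = u + v" "u \<in> Poly_Mapping.keys p" "v \<in> Poly_Mapping.keys q"
    using keys_mult [of p q] w by blast
  with x assms show "x \<in> S"
    by (auto simp: free_alg_def plus_word_def)
qed

lemma free_alg_single: "set (letters w) \<subseteq> S \<Longrightarrow> Poly_Mapping.single w c \<in> carrier (free_alg S)"
  by (auto simp: in_free_alg_iff lookup_single when_def)

lemma free_alg_const [intro, simp]: "const c \<in> carrier (free_alg S)"
  unfolding const_def by (rule free_alg_single) (simp add: zero_word_def)

lemma const_0: "const 0 = 0" and const_1: "const 1 = 1"
  and const_add: "const (a + b) = const a + const b"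
  and const_mult: "const (a * b) = const a * const b"
  and const_uminus: "const (- a) = - const a"
  by (simp_all add: const_def single_add mult_single single_uminus)

lemma free_alg_0 [intro, simp]: "0 \<in> carrier (free_alg S)"
  and free_alg_1 [intro, simp]: "1 \<in> carrier (free_alg S)"
  using free_alg_const [of 0 S] free_alg_const [of 1 S] by (simp_all add: const_0 const_1)

lemma free_alg_var [intro]: "x \<in> S \<Longrightarrow> var x \<in> carrier (free_alg S)"
  unfolding var_def by (rule free_alg_single) simp

lemma free_alg_sum [intro]:
  "(\<And>i. i \<in> J \<Longrightarrow> f i \<in> carrier (free_alg S)) \<Longrightarrow> sum f J \<in> carrier (free_alg S)"
  by (induction J rule: infinite_finite_induct) auto

lemma free_alg_power [intro]: "p \<in> carrier (free_alg S) \<Longrightarrow> p ^ k \<in> carrier (free_alg S)"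
  by (induction k) auto

lemma lookup_const_mult: "Poly_Mapping.lookup (const c * p) w = c * Poly_Mapping.lookup p w"
  by (simp add: const_def mult_map_scale_conv_mult [symmetric] Poly_Mapping.map.rep_eq when_def)

lemma poly_mapping_sum_singles:
  "p = (\<Sum>w \<in> Poly_Mapping.keys p. Poly_Mapping.single w (Poly_Mapping.lookup p w))"
  by (rule poly_mapping_eqI)
    (simp add: lookup_sum lookup_single when_def in_keys_iff)

lemma free_alg_induct_single [consumes 1, case_names single add]:
  assumes p: "p \<in> carrier (free_alg S)"
    and single: "\<And>w c. set (letters w) \<subseteq> S \<Longrightarrow> Q (Poly_Mapping.single w c)"
    and add: "\<And>p q. p \<in> carrier (free_alg S) \<Longrightarrow> q \<in> carrier (free_alg S) \<Longrightarrow> Q p \<Longrightarrow> Q q \<Longrightarrow> Q (p + q)"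
  shows "Q p"
proof -
  define s where "s W = (\<Sum>w \<in> W. Poly_Mapping.single w (Poly_Mapping.lookup p w))" for W
  have S: "set (letters w) \<subseteq> S" if "w \<in> Poly_Mapping.keys p" for w
    using p that by (simp add: free_alg_def)
  \<comment> \<open>Membership of the partial sums in the carrier is carried through the induction
    because the hypothesis on sums demands it.\<close>
  have "W \<subseteq> Poly_Mapping.keys p \<Longrightarrow> Q (s W) \<and> s W \<in> carrier (free_alg S)" if "finite W" for W
    using that
  proof (induction W)
    case empty
    have "Q 0" using single [of 0 0] by (simp add: zero_word_def)
    then show ?case by (simp add: s_def)
  next
    case (insert w W)
    then show ?case
      by (auto simp: s_def intro!: add free_alg_add single free_alg_single dest: S)
  qed
  then have "Q (s (Poly_Mapping.keys p))" by simp
  then show ?thesis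
    unfolding s_def poly_mapping_sum_singles [symmetric] .
qed

text \<open>A monomial is a product of variables ending in a constant: the coefficient sits on the
  empty word, and the letters are split off one by one from the left.\<close>

lemma free_alg_induct [consumes 1, case_names const var add mult]:
  assumes p: "p \<in> carrier (free_alg S)"
    and const: "\<And>c. Q (const c)"
    and var: "\<And>x. x \<in> S \<Longrightarrow> Q (var x)"
    and add: "\<And>p q. p \<in> carrier (free_alg S) \<Longrightarrow> q \<in> carrier (free_alg S) \<Longrightarrow> Q p \<Longrightarrow> Q q \<Longrightarrow> Q (p + q)"
    and mult: "\<And>p q. p \<in> carrier (free_alg S) \<Longrightarrow> q \<in> carrier (free_alg S) \<Longrightarrow> Q p \<Longrightarrow> Q q \<Longrightarrow> Q (p * q)"
  shows "Q p"
  using p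
proof (induction p rule: free_alg_induct_single)
  case (single w c)
  have "set xs \<subseteq> S \<Longrightarrow> Q (Poly_Mapping.single (Word xs) c)" for xs
  proof (induction xs)
    case Nil
    then show ?case using const [of c] by (simp add: const_def zero_word_def)
  next
    case (Cons x xs)
    have "Poly_Mapping.single (Word (x # xs)) c = var x * Poly_Mapping.single (Word xs) c"
      by (simp add: var_def mult_single plus_word_def)
    with Cons show ?case by (auto intro!: mult var free_alg_var free_alg_single)
  qed
  then show ?case using single by (metis word.collapse)
qed (rule add)

lemma ring_free_alg: "ring (free_alg S)"
proof (rule ringI)
  show "abelian_group (free_alg S)"
  proof (rule abelian_groupI)
    fix p :: "'a ncpoly" assume "p \<in> carrier (free_alg S)"
    then show "\<exists>q \<in> carrier (free_alg S). q \<oplus>\<^bsub>free_alg S\<^esub> p = \<zero>\<^bsub>free_alg S\<^esub>"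
      by (intro bexI [of _ "- p"]) auto
  qed (auto simp: algebra_simps)
  show "Group.monoid (free_alg S)"
    by (rule monoidI) (auto simp: algebra_simps)
qed (auto simp: algebra_simps)

lemma const_mult_commute: "p * const c = const c * p" for p :: "'x ncpoly"
proof -
  \<comment> \<open>Over the full alphabet the carrier condition is vacuous, so the induction rule
    covers every polynomial.\<close>
  have "p \<in> carrier (free_alg UNIV)" by (simp add: in_free_alg_iff)
  then show ?thesis
    by (induction p rule: free_alg_induct_single) (simp_all add: const_def mult_single algebra_simps)
qed

section \<open>Arithmetic of classes in a quotient by relations\<close>

locale presentation =
  fixes S :: "'x set" and R :: "'x ncpoly set"
  assumes rels_subset: "R \<subseteq> carrier (free_alg S)"
begin

abbreviation F where "F \<equiv> free_alg S"
abbreviation P where "P \<equiv> presented_alg S R"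
abbreviation I where "I \<equiv> Idl\<^bsub>F\<^esub> R"

sublocale ring F by (rule ring_free_alg)

interpretation rel_ideal: ideal I F by (rule genideal_ideal [OF rels_subset])

lemma cls_eq: "cls S R = (+>\<^bsub>F\<^esub>) I"
  by (simp add: cls_def fun_eq_iff)

lemma rel_in_ideal: "r \<in> R \<Longrightarrow> r \<in> I"
  using genideal_self [OF rels_subset] by blast

lemma ideal_add: "p \<in> I \<Longrightarrow> q \<in> I \<Longrightarrow> p + q \<in> I"
  using rel_ideal.a_closed [of p q] by simp

lemma ideal_mult_left: "p \<in> carrier F \<Longrightarrow> q \<in> I \<Longrightarrow> p * q \<in> I"
  using rel_ideal.I_l_closed [of q p] by simp

lemma ideal_mult_right: "p \<in> carrier F \<Longrightarrow> q \<in> I \<Longrightarrow> q * p \<in> I"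
  using rel_ideal.I_r_closed [of q p] by simp

lemma ideal_uminus: "p \<in> I \<Longrightarrow> - p \<in> I"
  using ideal_mult_left [of "- 1" p] by auto

lemma ideal_carrier: "p \<in> I \<Longrightarrow> p \<in> carrier F"
  by (rule rel_ideal.a_Hcarr)

lemma ideal_0: "0 \<in> I"
  using rel_ideal.zero_closed by simp

lemma ideal_sum: "(\<And>i. i \<in> J \<Longrightarrow> f i \<in> I) \<Longrightarrow> sum f J \<in> I"
  by (induction J rule: infinite_finite_induct) (auto intro: ideal_0 ideal_add)

lemma cls_eq_iff:
  assumes "p \<in> carrier F" "q \<in> carrier F"
  shows "cls S R p = cls S R q \<longleftrightarrow> p - q \<in> I"
proof
  assume "cls S R p = cls S R q"
  then have "p \<in> I +>\<^bsub>F\<^esub> q" using rel_ideal.a_rcos_self [OF assms(1)] by (simp add: cls_eq)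
  then show "p - q \<in> I" by (auto simp: a_r_coset_def r_coset_def)
next
  assume "p - q \<in> I"
  then have "(p - q) + q \<in> I +>\<^bsub>F\<^esub> q" unfolding a_r_coset_def r_coset_def by force
  then have "p \<in> I +>\<^bsub>F\<^esub> q" by simp
  then show "cls S R p = cls S R q"
    using rel_ideal.a_repr_independence' assms by (simp add: cls_eq)
qed

lemma carrier_P: "carrier P = cls S R ` carrier F"
  by (auto simp: presented_alg_def Let_def FactRing_def A_RCOSETS_def' cls_eq)

lemma cls_closed [intro]: "p \<in> carrier F \<Longrightarrow> cls S R p \<in> carrier P"
  by (simp add: carrier_P)

lemma cls_add:
  "p \<in> carrier F \<Longrightarrow> q \<in> carrier F \<Longrightarrow> cls S R p \<oplus>\<^bsub>P\<^esub> cls S R q = cls S R (p + q)"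
  using ring_hom_add [OF rel_ideal.rcos_ring_hom, of p q]
  by (simp add: cls_eq presented_alg_def Let_def)

lemma cls_mult:
  "p \<in> carrier F \<Longrightarrow> q \<in> carrier F \<Longrightarrow> cls S R p \<otimes>\<^bsub>P\<^esub> cls S R q = cls S R (p * q)"
  using ring_hom_mult [OF rel_ideal.rcos_ring_hom, of p q]
  by (simp add: cls_eq presented_alg_def Let_def)

lemma cls_one: "\<one>\<^bsub>P\<^esub> = cls S R 1"
  using ring_hom_one [OF rel_ideal.rcos_ring_hom]
  by (simp add: cls_eq presented_alg_def Let_def)

lemma cls_zero: "\<zero>\<^bsub>P\<^esub> = cls S R 0"
  by (auto simp: cls_eq presented_alg_def Let_def FactRing_def a_r_coset_def r_coset_def)

lemma cls_smult: "p \<in> carrier F \<Longrightarrow> c \<odot>\<^bsub>P\<^esub> cls S R p = cls S R (const c * p)"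
  using ring_hom_mult [OF rel_ideal.rcos_ring_hom, of "const c" p]
  by (simp add: cls_eq presented_alg_def Let_def)

lemmas cls_simps = cls_add cls_mult cls_one cls_zero cls_smult

lemma ring_presented: "ring P"
proof (rule ringI)
  show "abelian_group P"
  proof (rule abelian_groupI)
    fix x assume "x \<in> carrier P"
    then obtain p where p: "p \<in> carrier F" "x = cls S R p" by (auto simp: carrier_P)
    then have "cls S R (- p) \<in> carrier P" "cls S R (- p) \<oplus>\<^bsub>P\<^esub> x = \<zero>\<^bsub>P\<^esub>"
      by (auto simp: cls_simps free_alg_uminus)
    then show "\<exists>y \<in> carrier P. y \<oplus>\<^bsub>P\<^esub> x = \<zero>\<^bsub>P\<^esub>" by blast
  qed (auto simp: carrier_P cls_simps free_alg_add algebra_simps)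
  show "Group.monoid P"
    by (rule monoidI) (auto simp: carrier_P cls_simps free_alg_mult algebra_simps)
qed (auto simp: carrier_P cls_simps free_alg_mult free_alg_add algebra_simps)

lemma cls_uminus: "p \<in> carrier F \<Longrightarrow> \<ominus>\<^bsub>P\<^esub> cls S R p = cls S R (- p)"
  by (rule abelian_group.minus_equality [OF ring.is_abelian_group [OF ring_presented]])
    (auto simp: cls_simps free_alg_uminus)

lemma cls_diff:
  "p \<in> carrier F \<Longrightarrow> q \<in> carrier F \<Longrightarrow> cls S R p \<ominus>\<^bsub>P\<^esub> cls S R q = cls S R (p - q)"
  by (simp add: a_minus_def cls_uminus cls_add free_alg_uminus)

lemma cls_finsum:
  assumes "finite J" "\<And>i. i \<in> J \<Longrightarrow> f i \<in> carrier F"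
  shows "(\<Oplus>\<^bsub>P\<^esub> i \<in> J. cls S R (f i)) = cls S R (\<Sum>i \<in> J. f i)"
proof -
  interpret P: ring P by (rule ring_presented)
  show ?thesis using assms
  proof (induction J)
    case (insert j J)
    then show ?case
      using cls_add [of "f j" "sum f J"] by (simp add: P.finsum_insert Pi_def cls_closed free_alg_sum)
  qed (simp add: cls_zero)
qed

section \<open>Linear functionals, weak exponentials and derivations on the quotient\<close>

text \<open>Here \<open>q\<close> is \<open>p\<close> with its coefficients multiplied by
  \<open>h\<close>. The index set and the factors other than \<open>h\<close> depend on
  \<open>p\<close> alone, so for a sequence of multipliers, such as the terms of the exponential
  series, the finite sum over words can be exchanged with the limit.\<close>

lemma linear_functional_cls:
  assumes f: "linear_functional P f" and p: "p \<in> carrier F"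
    and h: "\<And>w. Poly_Mapping.lookup q w = h w * Poly_Mapping.lookup p w"
  shows "f (cls S R q) =
    (\<Sum>w \<in> Poly_Mapping.keys p. h w * (Poly_Mapping.lookup p w * f (cls S R (Poly_Mapping.single w 1))))"
proof -
  have S: "set (letters w) \<subseteq> S" if "w \<in> Poly_Mapping.keys p" for w
    using p that by (simp add: free_alg_def)
  have add: "f (cls S R (a + b)) = f (cls S R a) + f (cls S R b)"
    if "a \<in> carrier F" "b \<in> carrier F" for a b
    using f that unfolding linear_functional_def by (metis cls_add cls_closed)
  have scale: "f (cls S R (const c * a)) = c * f (cls S R a)" if "a \<in> carrier F" for a c
    using f that unfolding linear_functional_def by (metis cls_smult cls_closed)
  have 0: "f (cls S R 0) = 0" using scale [of 0 0] by (simp add: const_0)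
  have single: "f (cls S R (Poly_Mapping.single w c)) = c * f (cls S R (Poly_Mapping.single w 1))"
    if "set (letters w) \<subseteq> S" for w c
    using scale [of "Poly_Mapping.single w 1" c] that
    by (simp add: free_alg_single const_def mult_single)
  have f_sum: "f (cls S R (\<Sum>w \<in> W. Poly_Mapping.single w (h w * Poly_Mapping.lookup p w))) =
      (\<Sum>w \<in> W. f (cls S R (Poly_Mapping.single w (h w * Poly_Mapping.lookup p w))))"
    if "finite W" "W \<subseteq> Poly_Mapping.keys p" for W
    using that
  proof (induction W)
    case (insert w W)
    then show ?case
      by (subst sum.insert) (auto simp: S free_alg_single intro!: trans [OF add] free_alg_sum)
  qed (simp add: 0)
  have q: "q = (\<Sum>w \<in> Poly_Mapping.keys p. Poly_Mapping.single w (h w * Poly_Mapping.lookup p w))"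
    by (rule poly_mapping_eqI)
      (simp add: lookup_sum lookup_single when_def in_keys_iff h)
  have "f (cls S R q) =
      (\<Sum>w \<in> Poly_Mapping.keys p. f (cls S R (Poly_Mapping.single w (h w * Poly_Mapping.lookup p w))))"
    by (subst q, rule f_sum) simp_all
  also have "\<dots> = (\<Sum>w \<in> Poly_Mapping.keys p.
      h w * (Poly_Mapping.lookup p w * f (cls S R (Poly_Mapping.single w 1))))"
    by (rule sum.cong [OF refl], subst single) (use S in \<open>auto simp: mult.assoc\<close>)
  finally show ?thesis .
qed

lemma linear_functional_separates:
  assumes x: "x \<in> carrier P" and y: "y \<in> carrier P" and "x \<noteq> y"
  obtains f where "linear_functional P f" "f x \<noteq> f y"
proof -
  \<comment> \<open>The linear algebra takes place on the whole type of polynomials, with constants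
    acting as scalars; the target field is a vector space over itself.\<close>
  interpret V: vector_space "\<lambda>c (p :: 'x ncpoly). const c * p"
    by unfold_locales (simp_all add: algebra_simps const_add const_mult const_1)
  interpret VC: vector_space_pair "\<lambda>c (p :: 'x ncpoly). const c * p" "(*) :: complex \<Rightarrow> complex \<Rightarrow> complex"
    by unfold_locales (simp_all add: algebra_simps)
  obtain p q where p: "p \<in> carrier F" "x = cls S R p" and q: "q \<in> carrier F" "y = cls S R q"
    using x y by (auto simp: carrier_P)
  have npq: "p - q \<notin> I" using \<open>x \<noteq> y\<close> p q cls_eq_iff by auto
  have I: "V.subspace I"
    by (rule V.subspaceI) (auto intro: ideal_0 ideal_add ideal_mult_left)
  obtain B where B: "B \<subseteq> I" "V.independent B" "I \<subseteq> V.span B"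
    by (rule V.maximal_independent_subset)
  \<comment> \<open>A functional on the free algebra that vanishes on a basis of the ideal but not at \<open>p - q\<close> descends to
    the quotient and separates the two classes.\<close>
  have span: "V.span B = I" using B I V.span_minimal by blast
  have "V.independent (insert (p - q) B)"
    using B span npq by (intro V.independent_insertI) auto
  then obtain g where g: "Vector_Spaces.linear (\<lambda>c p. const c * p) (*) g"
    "\<And>b. b \<in> insert (p - q) B \<Longrightarrow> g b = (if b = p - q then 1 else 0)"
    using VC.linear_independent_extend [of "insert (p - q) B" "\<lambda>b. if b = p - q then 1 else 0"] by blast
  interpret g: Vector_Spaces.linear "\<lambda>c p. const c * p" "(*)" g by (rule g)
  have gI: "g a = 0" if "a \<in> I" for a
  proof (rule g.eq_0_on_span)
    show "a \<in> V.span B" using that span by blast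
    show "g b = 0" if "b \<in> B" for b
      using g(2) [of b] that B(1) npq by (metis insertI2 subsetD)
  qed
  \<comment> \<open>The value on a class is read off a chosen representative. The choice is
    immaterial because two representatives differ by an element of the ideal, where \<open>g\<close>
    vanishes.\<close>
  define f where "f z = g (SOME a. a \<in> carrier F \<and> z = cls S R a)" for z
  have f: "f (cls S R a) = g a" if a: "a \<in> carrier F" for a
  proof -
    define b where "b = (SOME b. b \<in> carrier F \<and> cls S R a = cls S R b)"
    have "b \<in> carrier F \<and> cls S R a = cls S R b"
      unfolding b_def by (rule someI [of _ a]) (simp add: a)
    then have "a - b \<in> I" using a cls_eq_iff by blast
    then have "g (a - b) = 0" by (rule gI)
    then show ?thesis by (simp add: f_def b_def g.diff)
  qed
  show ?thesis
  proof
    show "linear_functional P f"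
      by (auto simp: linear_functional_def carrier_P cls_simps f free_alg_add free_alg_mult g.add g.scale)
    show "f x \<noteq> f y"
      using g(2) [of "p - q"] by (auto simp: p q f g.diff)
  qed
qed

text \<open>Reduces the definite description to a convergence check: two weak sums of the same
  series agree under every functional, and functionals separate the carrier.\<close>

lemma op_exp_eqI:
  assumes "z \<in> carrier P"
    and "\<And>f. linear_functional P f \<Longrightarrow> (\<lambda>k. f ((T ^^ k) y) / fact k) sums f z"
  shows "op_exp P T y = z"
  unfolding op_exp_def
proof (rule the_equality)
  fix z' assume z': "z' \<in> carrier P \<and>
    (\<forall>f. linear_functional P f \<longrightarrow> (\<lambda>k. f ((T ^^ k) y) / fact k) sums f z')"
  show "z' = z"
  proof (rule ccontr)
    assume "z' \<noteq> z"
    with z' assms(1) obtain f where "linear_functional P f" "f z' \<noteq> f z"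
      using linear_functional_separates by blast
    with z' assms(2) show False using sums_unique2 by blast
  qed
qed (use assms in blast)

text \<open>The Leibniz rule applied to 1 * 1 shows that a derivation kills 1 and hence, by
  linearity, all constants. Agreement on generators then spreads through sums and products by
  induction over polynomials.\<close>

lemma derivation_eqI:
  assumes D: "derivation P D" and D': "derivation P D'"
    and gen: "\<And>x. x \<in> S \<Longrightarrow> D (cls S R (var x)) = D' (cls S R (var x))"
    and y: "y \<in> carrier P"
  shows "D y = D' y"
proof -
  interpret P: ring P by (rule ring_presented)
  have one: "E (cls S R 1) = \<zero>\<^bsub>P\<^esub>" if E: "derivation P E" for E
  proof -
    have c: "E \<one>\<^bsub>P\<^esub> \<in> carrier P" using E by (auto simp: derivation_def)
    have "E (\<one>\<^bsub>P\<^esub> \<otimes>\<^bsub>P\<^esub> \<one>\<^bsub>P\<^esub>) = E \<one>\<^bsub>P\<^esub> \<otimes>\<^bsub>P\<^esub> \<one>\<^bsub>P\<^esub> \<oplus>\<^bsub>P\<^esub> \<one>\<^bsub>P\<^esub> \<otimes>\<^bsub>P\<^esub> E \<one>\<^bsub>P\<^esub>"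
      using E unfolding derivation_def by blast
    then have "E \<one>\<^bsub>P\<^esub> = E \<one>\<^bsub>P\<^esub> \<oplus>\<^bsub>P\<^esub> E \<one>\<^bsub>P\<^esub>" using c by simp
    then show ?thesis using c P.add.l_cancel_one' by (metis cls_one)
  qed
  obtain p where p: "p \<in> carrier F" "y = cls S R p" using y by (auto simp: carrier_P)
  from p(1) have "D (cls S R p) = D' (cls S R p)"
  proof (induction p rule: free_alg_induct)
    case (const c)
    have "E (cls S R (const c)) = c \<odot>\<^bsub>P\<^esub> \<zero>\<^bsub>P\<^esub>" if E: "derivation P E" for E
    proof -
      have "E (c \<odot>\<^bsub>P\<^esub> cls S R 1) = c \<odot>\<^bsub>P\<^esub> E (cls S R 1)"
        using E cls_closed [of 1] unfolding derivation_def by simp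
      then show ?thesis by (simp add: one [OF E] cls_smult)
    qed
    with D D' show ?case by metis
  next
    case (add p q)
    then have "E (cls S R (p + q)) = E (cls S R p) \<oplus>\<^bsub>P\<^esub> E (cls S R q)" if "derivation P E" for E
      using that by (simp add: derivation_def cls_closed flip: cls_add)
    with D D' add show ?case by metis
  next
    case (mult p q)
    then have "E (cls S R (p * q)) =
        E (cls S R p) \<otimes>\<^bsub>P\<^esub> cls S R q \<oplus>\<^bsub>P\<^esub> cls S R p \<otimes>\<^bsub>P\<^esub> E (cls S R q)" if "derivation P E" for E
      using that by (simp add: derivation_def cls_closed flip: cls_mult)
    with D D' mult show ?case by metis
  qed (rule gen)
  with p(2) show ?thesis by simp
qed

lemma smult_closed: "x \<in> carrier P \<Longrightarrow> c \<odot>\<^bsub>P\<^esub> x \<in> carrier P"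
  by (auto simp: carrier_P cls_smult free_alg_mult)

lemma derivation_commutator:
  assumes "a \<in> carrier P"
  shows "derivation P (\<lambda>y. (a \<otimes>\<^bsub>P\<^esub> y) \<ominus>\<^bsub>P\<^esub> (y \<otimes>\<^bsub>P\<^esub> a))"
proof -
  \<comment> \<open>Scalars act as left multiplication by constants, so linearity of the commutator
    requires moving a constant past the left factor.\<close>
  have c: "q * (const c * p) = const c * (q * p)" for c and p q :: "'x ncpoly"
    using const_mult_commute [of q c] by (simp flip: mult.assoc)
  obtain p where p: "p \<in> carrier F" "a = cls S R p" using assms by (auto simp: carrier_P)
  then show ?thesis
    by (auto simp: derivation_def carrier_P cls_simps cls_diff free_alg_add free_alg_mult free_alg_diff c
        algebra_simps)
qed

section \<open>Transport along an algebra isomorphism\<close>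

lemma alg_iso_inv:
  assumes "alg_iso P A \<phi>"
  shows "alg_iso A P (inv_into (carrier P) \<phi>)"
proof -
  let ?\<psi> = "inv_into (carrier P) \<phi>"
  have \<phi>: "\<phi> \<in> ring_hom P A" "bij_betw \<phi> (carrier P) (carrier A)"
    "\<And>c x. x \<in> carrier P \<Longrightarrow> \<phi> (c \<odot>\<^bsub>P\<^esub> x) = c \<odot>\<^bsub>A\<^esub> \<phi> x"
    using assms by (auto simp: alg_iso_def)
  have "?\<psi> \<in> ring_iso A P"
    using ring_iso_set_sym [OF ring_presented] \<phi> by (auto simp: ring_iso_def)
  moreover have "?\<psi> (c \<odot>\<^bsub>A\<^esub> x) = c \<odot>\<^bsub>P\<^esub> ?\<psi> x" if x: "x \<in> carrier A" for c x
  proof -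
    have y: "?\<psi> x \<in> carrier P" "\<phi> (?\<psi> x) = x"
      using \<phi>(2) x by (auto simp: bij_betw_def inv_into_into f_inv_into_f)
    then have "?\<psi> (\<phi> (c \<odot>\<^bsub>P\<^esub> ?\<psi> x)) = c \<odot>\<^bsub>P\<^esub> ?\<psi> x"
      using \<phi>(2) by (intro inv_into_f_f) (auto simp: bij_betw_def smult_closed)
    with y show ?thesis by (simp add: \<phi>(3))
  qed
  ultimately show ?thesis by (simp add: alg_iso_def ring_iso_def)
qed

lemma derivation_transport:
  assumes \<phi>: "alg_iso P A \<phi>" and D: "derivation A D"
  shows "derivation P (transport P \<phi> D)"
proof -
  let ?\<psi> = "inv_into (carrier P) \<phi>"
  have \<psi>: "alg_iso A P ?\<psi>" by (rule alg_iso_inv [OF \<phi>])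
  interpret P: ring P by (rule ring_presented)
  have h: "\<phi> \<in> ring_hom P A" "\<And>c x. x \<in> carrier P \<Longrightarrow> \<phi> (c \<odot>\<^bsub>P\<^esub> x) = c \<odot>\<^bsub>A\<^esub> \<phi> x"
    "?\<psi> \<in> ring_hom A P" "\<And>c x. x \<in> carrier A \<Longrightarrow> ?\<psi> (c \<odot>\<^bsub>A\<^esub> x) = c \<odot>\<^bsub>P\<^esub> ?\<psi> x"
    using \<phi> \<psi> by (auto simp: alg_iso_def)
  have \<psi>\<phi>: "?\<psi> (\<phi> x) = x" if "x \<in> carrier P" for x
    using that \<phi> by (auto simp: alg_iso_def bij_betw_def)
  have Dc: "D x \<in> carrier A" if "x \<in> carrier A" for x
    using that D by (auto simp: derivation_def)
  \<comment> \<open>No ring axioms are assumed for \<open>A\<close>; closure under multiplication is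
    inherited from \<open>P\<close> through the isomorphism.\<close>
  have A: "x \<otimes>\<^bsub>A\<^esub> y \<in> carrier A" if "x \<in> carrier A" "y \<in> carrier A" for x y
  proof -
    have "\<phi> (?\<psi> x \<otimes>\<^bsub>P\<^esub> ?\<psi> y) \<in> carrier A"
      using that h by (simp add: ring_hom_closed)
    moreover have "\<phi> (?\<psi> z) = z" if "z \<in> carrier A" for z
      using that \<phi> by (auto simp: alg_iso_def bij_betw_def f_inv_into_f)
    ultimately show ?thesis
      using that h by (simp add: ring_hom_mult ring_hom_closed)
  qed
  show ?thesis
    unfolding derivation_def transport_def
  proof (intro conjI ballI allI)
    show "(\<lambda>y. ?\<psi> (D (\<phi> y))) \<in> carrier P \<rightarrow> carrier P"
      using h by (auto simp: ring_hom_closed Dc)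
    fix x y assume [simp]: "x \<in> carrier P" "y \<in> carrier P"
    have [simp]: "\<phi> x \<in> carrier A" "\<phi> y \<in> carrier A" using h by (auto simp: ring_hom_closed)
    show "?\<psi> (D (\<phi> (x \<oplus>\<^bsub>P\<^esub> y))) = ?\<psi> (D (\<phi> x)) \<oplus>\<^bsub>P\<^esub> ?\<psi> (D (\<phi> y))"
      using D by (simp add: derivation_def ring_hom_add [OF h(1)] ring_hom_add [OF h(3)] Dc)
    show "?\<psi> (D (\<phi> (c \<odot>\<^bsub>P\<^esub> x))) = c \<odot>\<^bsub>P\<^esub> ?\<psi> (D (\<phi> x))" for c
      using D by (simp add: derivation_def h(2,4) Dc)
    have "D (\<phi> (x \<otimes>\<^bsub>P\<^esub> y)) = D (\<phi> x) \<otimes>\<^bsub>A\<^esub> \<phi> y \<oplus>\<^bsub>A\<^esub> \<phi> x \<otimes>\<^bsub>A\<^esub> D (\<phi> y)"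
      using D by (simp add: derivation_def ring_hom_mult [OF h(1)])
    then show "?\<psi> (D (\<phi> (x \<otimes>\<^bsub>P\<^esub> y))) = ?\<psi> (D (\<phi> x)) \<otimes>\<^bsub>P\<^esub> y \<oplus>\<^bsub>P\<^esub> x \<otimes>\<^bsub>P\<^esub> ?\<psi> (D (\<phi> y))"
      by (simp add: ring_hom_add [OF h(3)] ring_hom_mult [OF h(3)] A Dc \<psi>\<phi>)
  qed
qed

text \<open>A functional on \<open>P\<close> composed with the inverse of \<phi> is a functional on
  \<open>A\<close>, so weak convergence passes from \<open>A\<close> to \<open>P\<close>. The
  hypothesis is convergence in \<open>A\<close> and not a value of \<open>op_exp\<close> there,
  because the value of a definite description alone would not guarantee that the series has a
  sum.\<close>

lemma op_exp_transport:
  assumes \<phi>: "alg_iso P A \<phi>"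
    and T: "\<And>x. x \<in> carrier P \<Longrightarrow> T x \<in> carrier P" "\<And>x. x \<in> carrier P \<Longrightarrow> \<phi> (T x) = T' (\<phi> x)"
    and y: "y \<in> carrier P" and z: "z \<in> carrier A"
    and sums: "\<And>f. linear_functional A f \<Longrightarrow> (\<lambda>k. f ((T' ^^ k) (\<phi> y)) / fact k) sums f z"
  shows "op_exp P T y = inv_into (carrier P) \<phi> z"
proof (rule op_exp_eqI)
  let ?\<psi> = "inv_into (carrier P) \<phi>"
  have \<psi>: "alg_iso A P ?\<psi>" by (rule alg_iso_inv [OF \<phi>])
  then have \<psi>_hom: "?\<psi> \<in> ring_hom A P" "\<And>c x. x \<in> carrier A \<Longrightarrow> ?\<psi> (c \<odot>\<^bsub>A\<^esub> x) = c \<odot>\<^bsub>P\<^esub> ?\<psi> x"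
    by (auto simp: alg_iso_def)
  then show "?\<psi> z \<in> carrier P" using z by (simp add: ring_hom_closed)
  have Tk: "(T ^^ k) y \<in> carrier P \<and> \<phi> ((T ^^ k) y) = (T' ^^ k) (\<phi> y)" for k
    by (induction k) (auto simp: y T)
  have \<psi>Tk: "?\<psi> ((T' ^^ k) (\<phi> y)) = (T ^^ k) y" for k
    using Tk [of k] \<phi> by (metis alg_iso_def bij_betw_def inv_into_f_f)
  fix f assume f: "linear_functional P f"
  have "linear_functional A (f \<circ> ?\<psi>)"
    using f \<psi>_hom by (auto simp: linear_functional_def ring_hom_add ring_hom_closed)
  from sums [OF this] show "(\<lambda>k. f ((T ^^ k) y) / fact k) sums f (?\<psi> z)"
    by (simp add: \<psi>Tk)
qed

end

section \<open>Graded presentations\<close>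

definition weight :: "('x \<Rightarrow> int) \<Rightarrow> 'x word \<Rightarrow> int" where
  "weight g w = sum_list (map g (letters w))"

text \<open>Any function \<open>h\<close> of the weight acts diagonally on words. With
  \<open>of_int\<close> this is the Euler operator, with powers its iterates, and with an
  exponential its exponential, so a single construction covers every operator needed.\<close>

definition rescale :: "('x \<Rightarrow> int) \<Rightarrow> (int \<Rightarrow> complex) \<Rightarrow> 'x ncpoly \<Rightarrow> 'x ncpoly" where
  "rescale g h = Poly_Mapping.mapp (\<lambda>w c. h (weight g w) * c)"

text \<open>Phrased through the support, so that the zero polynomial is homogeneous of every weight;
  the relations with a zero branch rely on this.\<close>

definition homogeneous :: "('x \<Rightarrow> int) \<Rightarrow> int \<Rightarrow> 'x ncpoly \<Rightarrow> bool" where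
  "homogeneous g d p \<longleftrightarrow> (\<forall>w. Poly_Mapping.lookup p w \<noteq> 0 \<longrightarrow> weight g w = d)"

lemma weight_add: "weight g (v + w) = weight g v + weight g w"
  by (simp add: weight_def plus_word_def)

lemma lookup_rescale: "Poly_Mapping.lookup (rescale g h p) w = h (weight g w) * Poly_Mapping.lookup p w"
  by (auto simp: rescale_def lookup_mapp when_def in_keys_iff)

lemma rescale_closed: "p \<in> carrier (free_alg S) \<Longrightarrow> rescale g h p \<in> carrier (free_alg S)"
  by (simp add: in_free_alg_iff lookup_rescale)

lemma rescale_add: "rescale g h (p + q) = rescale g h p + rescale g h q"
  by (rule poly_mapping_eqI) (simp add: lookup_rescale lookup_add algebra_simps)

lemma rescale_uminus: "rescale g h (- p) = - rescale g h p"
  by (rule poly_mapping_eqI) (simp add: lookup_rescale)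

lemma rescale_diff: "rescale g h (p - q) = rescale g h p - rescale g h q"
  using rescale_add [of g h p "- q"] by (simp add: rescale_uminus)

lemma rescale_const_mult: "rescale g h (const c * p) = const c * rescale g h p"
  by (rule poly_mapping_eqI) (simp add: lookup_rescale lookup_const_mult)

lemma const_mult_rescale: "const c * rescale g h p = rescale g (\<lambda>d. c * h d) p"
  by (rule poly_mapping_eqI) (simp add: lookup_rescale lookup_const_mult)

lemma rescale_rescale: "rescale g h (rescale g h' p) = rescale g (\<lambda>d. h d * h' d) p"
  by (rule poly_mapping_eqI) (simp add: lookup_rescale)

lemma rescale_one: "rescale g (\<lambda>d. 1) p = p"
  by (rule poly_mapping_eqI) (simp add: lookup_rescale)

lemma rescale_single:
  "rescale g h (Poly_Mapping.single w c) = Poly_Mapping.single w (h (weight g w) * c)"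
  by (rule poly_mapping_eqI) (simp add: lookup_rescale lookup_single when_def)

lemma rescale_homogeneous: "homogeneous g d p \<Longrightarrow> rescale g h p = const (h d) * p"
  by (rule poly_mapping_eqI) (auto simp: lookup_rescale lookup_const_mult homogeneous_def)

text \<open>The weight of a concatenation is the sum of the weights, and \<open>of_int\<close> is
  additive, so the Leibniz rule holds on monomials; both sides are biadditive.\<close>

lemma rescale_of_int_mult:
  "rescale g of_int (p * q) = rescale g of_int p * q + p * rescale g of_int q"
proof -
  have UNIV: "r \<in> carrier (free_alg UNIV)" for r :: "'a ncpoly" by (simp add: in_free_alg_iff)
  have "rescale g of_int (Poly_Mapping.single v a * q) =
      rescale g of_int (Poly_Mapping.single v a) * q + Poly_Mapping.single v a * rescale g of_int q" for v a
    using UNIV [of q]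
    by (induction q rule: free_alg_induct_single)
      (simp_all add: rescale_single mult_single weight_add rescale_add algebra_simps flip: single_add)
  with UNIV [of p] show ?thesis
    by (induction p rule: free_alg_induct_single) (simp_all add: rescale_add algebra_simps)
qed

lemma homogeneous_0: "homogeneous g d 0"
  and homogeneous_var: "homogeneous g (g x) (var x)"
  and homogeneous_const: "homogeneous g 0 (const c)"
  by (auto simp: homogeneous_def var_def const_def lookup_single when_def weight_def zero_word_def)

lemma homogeneous_1: "homogeneous g 0 1"
  using homogeneous_const [of g 1] by (simp add: const_1)

lemma homogeneous_add: "homogeneous g d p \<Longrightarrow> homogeneous g d q \<Longrightarrow> homogeneous g d (p + q)"
  by (auto simp: homogeneous_def lookup_add) (metis add.right_neutral)

lemma homogeneous_uminus: "homogeneous g d p \<Longrightarrow> homogeneous g d (- p)"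
  by (auto simp: homogeneous_def)

lemma homogeneous_diff: "homogeneous g d p \<Longrightarrow> homogeneous g d q \<Longrightarrow> homogeneous g d (p - q)"
  using homogeneous_add [of g d p "- q"] by (simp add: homogeneous_uminus)

text \<open>The weight of the product enters through an equation, so that the rule applies to a goal
  with any target weight and leaves the arithmetic to simplification.\<close>

lemma homogeneous_mult:
  assumes "homogeneous g a p" "homogeneous g b q" "d = a + b"
  shows "homogeneous g d (p * q)"
  unfolding homogeneous_def
proof (intro allI impI)
  fix w assume "Poly_Mapping.lookup (p * q) w \<noteq> 0"
  then obtain u v where "w = u + v" "u \<in> Poly_Mapping.keys p" "v \<in> Poly_Mapping.keys q"
    using keys_mult [of p q] by (auto simp flip: in_keys_iff)
  with assms show "weight g w = d"
    by (auto simp: homogeneous_def weight_add in_keys_iff)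
qed

lemma homogeneous_power_0: "homogeneous g 0 p \<Longrightarrow> homogeneous g 0 (p ^ k)"
  by (induction k) (auto intro: homogeneous_1 homogeneous_mult)

lemma homogeneous_sum: "(\<And>i. i \<in> J \<Longrightarrow> homogeneous g d (f i)) \<Longrightarrow> homogeneous g d (sum f J)"
  by (induction J rule: infinite_finite_induct) (auto intro: homogeneous_0 homogeneous_add)

section \<open>The Euler derivation of a graded quotient and its exponential\<close>

locale graded_presentation = presentation S R
  for S :: "'x set" and R :: "'x ncpoly set" +
  fixes g :: "'x \<Rightarrow> int"
  assumes homogeneous_rels: "r \<in> R \<Longrightarrow> \<exists>d. homogeneous g d r"
begin

abbreviation deg where "deg \<equiv> rescale g of_int"

text \<open>The elements of the ideal whose image stays in the ideal form an ideal themselves, by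
  the Leibniz rule. It contains each relation, since a homogeneous relation is only multiplied by a
  scalar, so minimality of the generated ideal gives the claim.\<close>

lemma deg_ideal: "p \<in> I \<Longrightarrow> deg p \<in> I"
proof -
  let ?J = "{p \<in> I. deg p \<in> I}"
  \<comment> \<open>The subgroup condition speaks of inverses in the additive monoid, which have to
    be identified with negatives of polynomials.\<close>
  have neg: "inv\<^bsub>add_monoid F\<^esub> p = - p" if "p \<in> carrier F" for p
    using minus_equality [of "- p" p] that by (auto simp: a_inv_def)
  have "ideal ?J F"
  proof (rule idealI [OF ring_free_alg])
    have "deg 0 = 0" using rescale_const_mult [of g of_int 0 0] by (simp add: const_0)
    then show "subgroup ?J (add_monoid F)"
      by unfold_locales
        (auto simp: ideal_carrier neg [simplified] rescale_add rescale_uminus ideal_add ideal_uminus ideal_0)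
    fix a x assume ax: "a \<in> ?J" "x \<in> carrier F"
    then have "x * a \<in> I" "deg x * a \<in> I" "x * deg a \<in> I" "a * x \<in> I" "deg a * x \<in> I" "a * deg x \<in> I"
      by (simp_all add: ideal_mult_left ideal_mult_right rescale_closed)
    then show "x \<otimes>\<^bsub>F\<^esub> a \<in> ?J" "a \<otimes>\<^bsub>F\<^esub> x \<in> ?J"
      by (simp_all add: rescale_of_int_mult ideal_add)
  qed
  moreover have "R \<subseteq> ?J"
  proof
    fix r assume r: "r \<in> R"
    with homogeneous_rels obtain d where "homogeneous g d r" by blast
    then show "r \<in> ?J"
      using r by (simp add: rescale_homogeneous rel_in_ideal ideal_mult_left)
  qed
  ultimately have "I \<subseteq> ?J" by (rule genideal_minimal)
  then show "p \<in> I \<Longrightarrow> deg p \<in> I" by blast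
qed

text \<open>Restriction to the carrier makes the function extensional, as the description of
  \<open>N_act\<close> demands. The choice of representative is harmless because \<open>deg\<close>
  preserves the ideal.\<close>

definition euler :: "'x ncpoly set \<Rightarrow> 'x ncpoly set" where
  "euler = (\<lambda>y \<in> carrier P. cls S R (deg (SOME p. p \<in> carrier F \<and> y = cls S R p)))"

lemma euler_cls:
  assumes "p \<in> carrier F"
  shows "euler (cls S R p) = cls S R (deg p)"
proof -
  define q where "q = (SOME q. q \<in> carrier F \<and> cls S R p = cls S R q)"
  have q: "q \<in> carrier F \<and> cls S R p = cls S R q"
    unfolding q_def by (rule someI [of _ p]) (simp add: assms)
  then have "p - q \<in> I" using assms cls_eq_iff by blast
  then have "deg p - deg q \<in> I" using deg_ideal rescale_diff by metis
  then have "cls S R (deg p) = cls S R (deg q)"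
    using q assms by (simp add: cls_eq_iff rescale_closed)
  then show ?thesis using assms by (simp add: euler_def q_def cls_closed)
qed

lemma derivation_euler: "derivation P euler"
  by (auto simp: derivation_def carrier_P cls_simps euler_cls rescale_closed free_alg_add free_alg_mult
      rescale_add rescale_const_mult rescale_of_int_mult)

lemma euler_homogeneous:
  "p \<in> carrier F \<Longrightarrow> homogeneous g d p \<Longrightarrow> euler (cls S R p) = of_int d \<odot>\<^bsub>P\<^esub> cls S R p"
  by (simp add: euler_cls rescale_homogeneous cls_smult)

text \<open>Multipliers of diagonal operators multiply under composition, so each iterate is again
  one rescaling of the same polynomial.\<close>

lemma euler_power_cls:
  assumes "p \<in> carrier F"
  shows "((\<lambda>y. c \<odot>\<^bsub>P\<^esub> euler y) ^^ k) (cls S R p) = cls S R (rescale g (\<lambda>d. (c * of_int d) ^ k) p)"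
  by (induction k)
    (simp_all add: assms rescale_one euler_cls cls_smult rescale_closed rescale_rescale const_mult_rescale mult.assoc)

text \<open>Under \<open>f\<close> the term number \<open>k\<close> is a sum over the finitely many
  words of \<open>p\<close> in which \<open>k\<close> enters only through scalar powers and
  factorials. The series thus splits into finitely many scalar exponential series. It is kept apart
  from \<open>op_exp_euler\<close> because transport to another algebra needs the convergence
  itself.\<close>

lemma exp_euler_sums:
  assumes p: "p \<in> carrier F" and f: "linear_functional P f"
  shows "(\<lambda>k. f (((\<lambda>y. c \<odot>\<^bsub>P\<^esub> euler y) ^^ k) (cls S R p)) / fact k) sums
    f (cls S R (rescale g (\<lambda>d. exp (c * of_int d)) p))"
proof -
  let ?a = "\<lambda>w. Poly_Mapping.lookup p w * f (cls S R (Poly_Mapping.single w 1))"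
  have f_rescale: "f (cls S R (rescale g h p)) =
      (\<Sum>w \<in> Poly_Mapping.keys p. h (weight g w) * ?a w)" for h
    by (rule linear_functional_cls [OF f p]) (simp add: lookup_rescale)
  \<comment> \<open>The scaling by a real inverse factorial is the form in which the scalar
    exponential series is available; it is turned into division afterwards.\<close>
  have "(\<lambda>k. \<Sum>w \<in> Poly_Mapping.keys p. (c * of_int (weight g w)) ^ k /\<^sub>R fact k * ?a w) sums
      (\<Sum>w \<in> Poly_Mapping.keys p. exp (c * of_int (weight g w)) * ?a w)"
    by (intro sums_sum sums_mult2 exp_converges)
  then show ?thesis
    by (simp add: euler_power_cls p f_rescale sum_divide_distrib scaleR_conv_of_real field_simps)
qed

lemma op_exp_euler:
  "p \<in> carrier F \<Longrightarrow>
    op_exp P (\<lambda>y. c \<odot>\<^bsub>P\<^esub> euler y) (cls S R p) = cls S R (rescale g (\<lambda>d. exp (c * of_int d)) p)"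
  by (rule op_exp_eqI) (auto intro: exp_euler_sums rescale_closed)

lemma op_exp_euler_homogeneous:
  "p \<in> carrier F \<Longrightarrow> homogeneous g d p \<Longrightarrow>
    op_exp P (\<lambda>y. c \<odot>\<^bsub>P\<^esub> euler y) (cls S R p) = exp (c * of_int d) \<odot>\<^bsub>P\<^esub> cls S R p"
  by (simp add: op_exp_euler rescale_homogeneous cls_smult)

end

section \<open>The braided algebra is graded\<close>

fun gen_weight :: "gen \<Rightarrow> int" where
  "gen_weight (Ad_gen i) = 1"
| "gen_weight (A_gen i) = - 1"
| "gen_weight _ = 0"

text \<open>Collects the prescribed images under \<phi> of all six kinds of generators, so that they
  can be treated uniformly.\<close>

fun diagonal_gen :: "complex \<Rightarrow> gen \<Rightarrow> gen ncpoly" where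
  "diagonal_gen \<omega> (Ad_gen i) = Xd \<omega> i"
| "diagonal_gen \<omega> (A_gen i) = X i"
| "diagonal_gen \<omega> (N_gen i) = M \<omega> i"
| "diagonal_gen \<omega> x = var x"

lemma in_gens_iff [simp]:
  "A_gen i \<in> gens n \<longleftrightarrow> i \<in> {1..n}" "Ad_gen i \<in> gens n \<longleftrightarrow> i \<in> {1..n}"
  "N_gen i \<in> gens n \<longleftrightarrow> i \<in> {1..n}" "H_gen i \<in> gens n \<longleftrightarrow> i \<in> {1..n}"
  "Exp_gen i \<in> gens n \<longleftrightarrow> i \<in> {1..n}" "Expinv_gen i \<in> gens n \<longleftrightarrow> i \<in> {1..n}"
  by (auto simp: gens_def)

section \<open>Relations and diagonalised generators lie in the free algebra\<close>

lemma ex_closed: "i \<in> {1..n} \<Longrightarrow> ex m i \<in> carrier (free_alg (gens n))"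
  by (auto simp: ex_def intro!: free_alg_power free_alg_var)

lemma exs_closed:
  assumes "{a..<b} \<subseteq> {1..n}"
  shows "exs m a b \<in> carrier (free_alg (gens n))"
proof -
  have "set js \<subseteq> {1..n} \<Longrightarrow> prod_list (map (ex m) js) \<in> carrier (free_alg (gens n))" for js
    by (induction js) (auto intro!: free_alg_mult ex_closed)
  with assms show ?thesis by (simp add: exs_def)
qed

lemma comm_closed:
  "p \<in> carrier (free_alg S) \<Longrightarrow> q \<in> carrier (free_alg S) \<Longrightarrow> comm p q \<in> carrier (free_alg S)"
  by (auto simp: comm_def intro!: free_alg_diff free_alg_mult)

lemma if_closed:
  "(c \<Longrightarrow> p \<in> carrier (free_alg S)) \<Longrightarrow> (\<not> c \<Longrightarrow> q \<in> carrier (free_alg S)) \<Longrightarrow>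
    (if c then p else q) \<in> carrier (free_alg S)"
  by simp

lemma qH_closed: "i \<in> {1..n} \<Longrightarrow> qH \<omega> i \<in> carrier (free_alg (gens n))"
  unfolding qH_def by (intro free_alg_mult free_alg_diff free_alg_const ex_closed)

lemmas closed_intros = if_closed comm_closed free_alg_sum free_alg_diff free_alg_add free_alg_uminus
  free_alg_mult free_alg_const free_alg_0 free_alg_1 free_alg_var ex_closed exs_closed qH_closed

lemma central_rels_closed: "central_rels n \<subseteq> carrier (free_alg (gens n))"
  unfolding central_rels_def
  by (auto intro!: closed_intros)

lemma U_rels_closed: "U_rels \<omega> n \<subseteq> carrier (free_alg (gens n))"
  unfolding U_rels_def
  by (intro Un_least UN_least insert_subsetI empty_subsetI central_rels_closed)
    ((rule closed_intros | simp)+)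

lemma BU_rels_closed: "BU_rels \<omega> n \<subseteq> carrier (free_alg (gens n))"
  unfolding BU_rels_def
  apply (intro Un_least UN_least insert_subsetI empty_subsetI central_rels_closed)
  \<comment> \<open>The bound confines the method to the five relations of the doubly indexed
    family. The relation between the number generators is a set comprehension and has to be unpacked
    first.\<close>
  apply ((rule closed_intros | simp)+) [5]
  apply (rule subsetI, elim CollectE exE conjE, hypsubst)
  by ((rule closed_intros | simp)+)

lemma diagonal_gen_closed:
  assumes "x \<in> gens n"
  shows "diagonal_gen \<omega> x \<in> carrier (free_alg (gens n))"
  using assms
  by (cases x; simp only: diagonal_gen.simps X_def Xd_def M_def; intro closed_intros) auto

section \<open>Weights of the diagonalised generators and of the relations\<close>

lemma homogeneous_gA: "homogeneous gen_weight (- 1) (gA i)"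
  and homogeneous_gAd: "homogeneous gen_weight 1 (gAd i)"
  and homogeneous_gN: "homogeneous gen_weight 0 (gN i)"
  and homogeneous_gH: "homogeneous gen_weight 0 (gH i)"
  and homogeneous_gE: "homogeneous gen_weight 0 (gE i)"
  and homogeneous_gEi: "homogeneous gen_weight 0 (gEi i)"
  using homogeneous_var [of gen_weight "A_gen i"] homogeneous_var [of gen_weight "Ad_gen i"]
    homogeneous_var [of gen_weight "N_gen i"] homogeneous_var [of gen_weight "H_gen i"]
    homogeneous_var [of gen_weight "Exp_gen i"] homogeneous_var [of gen_weight "Expinv_gen i"]
  by simp_all

lemma homogeneous_ex: "homogeneous gen_weight 0 (ex m i)"
  by (simp add: ex_def homogeneous_power_0 homogeneous_gE homogeneous_gEi)

lemma homogeneous_exs: "homogeneous gen_weight 0 (exs m a b)"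
proof -
  have "homogeneous gen_weight 0 (prod_list (map (ex m) js))" for js
    by (induction js) (auto intro: homogeneous_1 homogeneous_mult homogeneous_ex)
  then show ?thesis by (simp add: exs_def)
qed

lemma homogeneous_qH: "homogeneous gen_weight 0 (qH \<omega> i)"
  unfolding qH_def
  by (rule homogeneous_mult homogeneous_const homogeneous_diff homogeneous_ex | simp)+

lemma homogeneous_comm:
  "homogeneous g a p \<Longrightarrow> homogeneous g b q \<Longrightarrow> d = a + b \<Longrightarrow> homogeneous g d (comm p q)"
  by (auto simp: comm_def intro!: homogeneous_diff homogeneous_mult)

lemma homogeneous_if:
  "(c \<Longrightarrow> homogeneous g d p) \<Longrightarrow> (\<not> c \<Longrightarrow> homogeneous g d q) \<Longrightarrow> homogeneous g d (if c then p else q)"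
  by simp

lemmas homogeneous_intros = homogeneous_if homogeneous_comm homogeneous_sum homogeneous_diff
  homogeneous_add homogeneous_uminus homogeneous_mult homogeneous_const homogeneous_0 homogeneous_1
  homogeneous_gA homogeneous_gAd homogeneous_gN homogeneous_gH homogeneous_gE homogeneous_gEi
  homogeneous_ex homogeneous_exs homogeneous_qH

text \<open>Exponentials and \<open>qH\<close> have weight 0. The corrections in \<open>Xd\<close>
  each contain one daggered generator, and those in \<open>M\<close> pair a daggered with an
  undaggered one, so no correction disturbs the weight of the leading term.\<close>

lemma homogeneous_diagonal_gen: "homogeneous gen_weight (gen_weight x) (diagonal_gen \<omega> x)"
  by (cases x; simp only: diagonal_gen.simps gen_weight.simps X_def Xd_def M_def;
      (rule homogeneous_intros | simp)+)

lemma central_rels_homogeneous: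
  assumes "r \<in> central_rels n"
  shows "\<exists>d. homogeneous gen_weight d r"
proof -
  have "homogeneous gen_weight 0 (gE i * gEi i - 1)" "homogeneous gen_weight 0 (gEi i * gE i - 1)" for i
    by (rule homogeneous_intros | simp)+
  moreover have "homogeneous gen_weight (gen_weight z + gen_weight x) (comm (var z) (var x))" for z x
    by (rule homogeneous_comm [OF homogeneous_var homogeneous_var refl])
  ultimately show ?thesis
    using assms unfolding central_rels_def by blast
qed

text \<open>A commutator has the sum of the weights of its entries, and each braiding term matches
  it: on the right of the relation for two number generators, for instance, \<open>gAd\<close> and
  \<open>gA\<close> cancel to weight 0. The witnesses in the proof follow the order of the relations
  in \<open>BU_rels\<close>.\<close>

lemma BU_rels_homogeneous: "r \<in> BU_rels \<omega> n \<Longrightarrow> \<exists>d. homogeneous gen_weight d r"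
  unfolding BU_rels_def
  apply (elim UnE UN_E insertE emptyE CollectE exE conjE; (hypsubst_thin)?)
  subgoal by (rule central_rels_homogeneous)
  subgoal by (rule exI [of _ "- 2"], (rule homogeneous_intros | simp)+)
  subgoal by (rule exI [of _ "2"], (rule homogeneous_intros | simp)+)
  subgoal by (rule exI [of _ "0"], (rule homogeneous_intros | simp)+)
  subgoal by (rule exI [of _ "- 1"], (rule homogeneous_intros | simp)+)
  subgoal by (rule exI [of _ "1"], (rule homogeneous_intros | simp)+)
  subgoal by (rule exI [of _ "0"], (rule homogeneous_intros | simp)+)
  done

interpretation U: presentation "gens n" "U_rels \<omega> n" for \<omega> n
  by unfold_locales (rule U_rels_closed)

interpretation BU: graded_presentation "gens n" "BU_rels \<omega> n" gen_weight for \<omega> n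
  by unfold_locales (rule BU_rels_closed, rule BU_rels_homogeneous)

text \<open>The Euler derivation satisfies the description, and any other candidate agrees with it
  on generators, hence on the carrier; outside the carrier extensionality forces equality.\<close>

lemma N_act_eq_euler: "N_act \<omega> n = BU.euler n \<omega>"
proof -
  have cls: "BU_cls \<omega> n = cls (gens n) (BU_rels \<omega> n)"
    and alg: "BU_alg \<omega> n = presented_alg (gens n) (BU_rels \<omega> n)"
    by (simp_all add: BU_cls_def BU_alg_def fun_eq_iff)
  have euler_var: "BU.euler n \<omega> (cls (gens n) (BU_rels \<omega> n) (var x)) =
      cls (gens n) (BU_rels \<omega> n) (const (of_int (gen_weight x)) * var x)" if "x \<in> gens n" for x
    using that by (simp add: BU.euler_cls free_alg_var rescale_homogeneous [OF homogeneous_var])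
  have uminus: "- gA i = const (- 1) * gA i" for i
    by (simp add: const_uminus const_1)
  show ?thesis
    unfolding N_act_def cls alg
  proof (rule the_equality)
    show "BU.euler n \<omega> \<in> extensional (carrier (BU.P n \<omega>)) \<and> derivation (BU.P n \<omega>) (BU.euler n \<omega>) \<and>
      (\<forall>i \<in> {1..n}.
        BU.euler n \<omega> (cls (gens n) (BU_rels \<omega> n) (gAd i)) = cls (gens n) (BU_rels \<omega> n) (gAd i) \<and>
        BU.euler n \<omega> (cls (gens n) (BU_rels \<omega> n) (gA i)) =
          \<ominus>\<^bsub>BU.P n \<omega>\<^esub> cls (gens n) (BU_rels \<omega> n) (gA i) \<and>
        BU.euler n \<omega> (cls (gens n) (BU_rels \<omega> n) (gN i)) = \<zero>\<^bsub>BU.P n \<omega>\<^esub> \<and>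
        BU.euler n \<omega> (cls (gens n) (BU_rels \<omega> n) (gH i)) = \<zero>\<^bsub>BU.P n \<omega>\<^esub> \<and>
        BU.euler n \<omega> (cls (gens n) (BU_rels \<omega> n) (gE i)) = \<zero>\<^bsub>BU.P n \<omega>\<^esub> \<and>
        BU.euler n \<omega> (cls (gens n) (BU_rels \<omega> n) (gEi i)) = \<zero>\<^bsub>BU.P n \<omega>\<^esub>)"
      by (simp add: BU.derivation_euler euler_var const_0 const_1 const_uminus BU.cls_zero BU.cls_uminus
          free_alg_var) (simp add: BU.euler_def)
  next
    fix D assume D: "D \<in> extensional (carrier (BU.P n \<omega>)) \<and> derivation (BU.P n \<omega>) D \<and>
      (\<forall>i \<in> {1..n}.
        D (cls (gens n) (BU_rels \<omega> n) (gAd i)) = cls (gens n) (BU_rels \<omega> n) (gAd i) \<and>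
        D (cls (gens n) (BU_rels \<omega> n) (gA i)) = \<ominus>\<^bsub>BU.P n \<omega>\<^esub> cls (gens n) (BU_rels \<omega> n) (gA i) \<and>
        D (cls (gens n) (BU_rels \<omega> n) (gN i)) = \<zero>\<^bsub>BU.P n \<omega>\<^esub> \<and>
        D (cls (gens n) (BU_rels \<omega> n) (gH i)) = \<zero>\<^bsub>BU.P n \<omega>\<^esub> \<and>
        D (cls (gens n) (BU_rels \<omega> n) (gE i)) = \<zero>\<^bsub>BU.P n \<omega>\<^esub> \<and>
        D (cls (gens n) (BU_rels \<omega> n) (gEi i)) = \<zero>\<^bsub>BU.P n \<omega>\<^esub>)"
    have "D (cls (gens n) (BU_rels \<omega> n) (var x)) = BU.euler n \<omega> (cls (gens n) (BU_rels \<omega> n) (var x))"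
      if "x \<in> gens n" for x
      using that D
      by (cases x) (simp_all add: euler_var const_0 const_1 const_uminus BU.cls_zero BU.cls_uminus
          free_alg_var)
    then have "D y = BU.euler n \<omega> y" if "y \<in> carrier (BU.P n \<omega>)" for y
      using BU.derivation_eqI [OF _ BU.derivation_euler _ that, of D] D by blast
    then show "D = BU.euler n \<omega>"
      using D by (intro extensionalityI [of _ "carrier (BU.P n \<omega>)"]) (auto simp: BU.euler_def)
  qed
qed

section \<open>The free Hamiltonian\<close>

lemma Ham_eq: "Ham \<omega> n = cls (gens n) (U_rels \<omega> n) (\<Sum>i \<in> {1..n}. gN i)"
  unfolding Ham_def U_alg_def U_cls_def by (rule U.cls_finsum) (auto intro!: free_alg_var)

lemma Ham_closed: "Ham \<omega> n \<in> carrier (U_alg \<omega> n)"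
  unfolding Ham_eq U_alg_def by (intro U.cls_closed free_alg_sum free_alg_var) auto

lemma derivation_ad_Ham: "derivation (U_alg \<omega> n) (ad_Ham \<omega> n)"
  using U.derivation_commutator [of "Ham \<omega> n" n \<omega>] Ham_closed
  by (simp add: U_alg_def ad_Ham_def [abs_def])

lemma comm_sum: "comm (sum f J) p = (\<Sum>i \<in> J. comm (f i) p)"
  by (simp add: comm_def sum_subtractf sum_distrib_left sum_distrib_right)

text \<open>The premise \<open>rel\<close> has the shape of the defining relations. Summed over all
  \<open>i\<close>, the conditional contributes \<open>q\<close> exactly once, since
  \<open>j\<close> lies in the range, and the commutator with the Hamiltonian is congruent to
  \<open>q\<close>.\<close>

lemma ad_Ham_cls:
  assumes p: "p \<in> carrier (free_alg (gens n))" and q: "q \<in> carrier (free_alg (gens n))"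
    and j: "j \<in> {1..n}"
    and rel: "\<And>i. i \<in> {1..n} \<Longrightarrow> comm (gN i) p - (if i = j then q else 0) \<in> U.I n \<omega>"
  shows "ad_Ham \<omega> n (U_cls \<omega> n p) = U_cls \<omega> n q"
proof -
  define H where "H = (\<Sum>i \<in> {1..n}. gN i)"
  have H: "H \<in> carrier (free_alg (gens n))" unfolding H_def by (intro free_alg_sum free_alg_var) simp
  have Ham: "Ham \<omega> n = cls (gens n) (U_rels \<omega> n) H"
    by (simp only: Ham_eq H_def)
  have "ad_Ham \<omega> n (U_cls \<omega> n p) = U_cls \<omega> n (comm H p)"
    by (simp add: ad_Ham_def Ham U_alg_def U_cls_def U.cls_mult U.cls_diff H p free_alg_mult comm_def)
  also have "\<dots> = U_cls \<omega> n q"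
  proof -
    have "comm H p - q = (\<Sum>i \<in> {1..n}. comm (gN i) p - (if i = j then q else 0))"
      using j by (simp add: H_def comm_sum sum_subtractf)
    also have "\<dots> \<in> U.I n \<omega>"
      by (intro U.ideal_sum rel)
    finally show ?thesis
      unfolding U_cls_def by (subst U.cls_eq_iff) (auto intro: comm_closed H p q)
  qed
  finally show ?thesis .
qed

text \<open>The eigenvalue is written as \<open>gen_weight\<close> to match the one by which the
  Euler derivation acts on the corresponding diagonalised generator.\<close>

lemma ad_Ham_gen:
  assumes x: "x \<in> gens n"
  shows "ad_Ham \<omega> n (U_cls \<omega> n (var x)) = of_int (gen_weight x) \<odot>\<^bsub>U_alg \<omega> n\<^esub> U_cls \<omega> n (var x)"
proof -
  \<comment> \<open>The trivial conditional reproduces the pattern of the premise of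
    \<open>ad_Ham_cls\<close> for \<open>q\<close> equal to 0.\<close>
  have central: "comm (gN i) (var z) - (if i = j then 0 else 0) \<in> U.I n \<omega>"
    if "i \<in> {1..n}" "j \<in> {1..n}" "z \<in> {H_gen j, Exp_gen j, Expinv_gen j}" for i j z
  proof -
    \<comment> \<open>The centrality relations list the central generator first, whence the change
      of sign.\<close>
    have "comm (var z) (gN i) \<in> central_rels n"
      unfolding central_rels_def using that by fastforce
    then have "- comm (var z) (gN i) \<in> U.I n \<omega>"
      by (intro U.ideal_uminus U.rel_in_ideal) (simp add: U_rels_def)
    then show ?thesis by (simp add: comm_def)
  qed
  have rel: "comm (gN i) (gA j) + (if i = j then gA i else 0) \<in> U.I n \<omega>"
    "comm (gN i) (gAd j) - (if i = j then gAd i else 0) \<in> U.I n \<omega>"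
    "comm (gN i) (gN j) \<in> U.I n \<omega>" if "i \<in> {1..n}" "j \<in> {1..n}" for i j
    using that by (intro U.rel_in_ideal; unfold U_rels_def; blast)+
  have "ad_Ham \<omega> n (U_cls \<omega> n (var x)) = U_cls \<omega> n (const (of_int (gen_weight x)) * var x)"
  proof (cases x)
    case (A_gen j)
    then have j: "j \<in> {1..n}" using x by simp
    have "ad_Ham \<omega> n (U_cls \<omega> n (gA j)) = U_cls \<omega> n (- gA j)"
    proof (rule ad_Ham_cls [OF _ _ j])
      fix i assume "i \<in> {1..n}"
      from rel(1) [OF this j]
      show "comm (gN i) (gA j) - (if i = j then - gA j else 0) \<in> U.I n \<omega>"
        by (auto split: if_splits)
    qed (use j in \<open>auto intro!: free_alg_var free_alg_uminus\<close>)
    then show ?thesis by (simp add: A_gen const_uminus const_1)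
  next
    case (Ad_gen j)
    then have j: "j \<in> {1..n}" using x by simp
    have "ad_Ham \<omega> n (U_cls \<omega> n (gAd j)) = U_cls \<omega> n (gAd j)"
    proof (rule ad_Ham_cls [OF _ _ j])
      fix i assume "i \<in> {1..n}"
      from rel(2) [OF this j]
      show "comm (gN i) (gAd j) - (if i = j then gAd j else 0) \<in> U.I n \<omega>"
        by (auto split: if_splits)
    qed (use j in \<open>auto intro!: free_alg_var\<close>)
    then show ?thesis by (simp add: Ad_gen const_1)
  next
    case (N_gen j)
    then have j: "j \<in> {1..n}" using x by simp
    have "ad_Ham \<omega> n (U_cls \<omega> n (gN j)) = U_cls \<omega> n 0"
      using j rel by (intro ad_Ham_cls [OF _ _ j]) (auto intro!: free_alg_var)
    then show ?thesis by (simp add: N_gen const_0)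
  next
    case (H_gen j)
    then have j: "j \<in> {1..n}" using x by simp
    have "ad_Ham \<omega> n (U_cls \<omega> n (gH j)) = U_cls \<omega> n 0"
      using j by (intro ad_Ham_cls [OF _ _ j] central) (auto intro!: free_alg_var)
    then show ?thesis by (simp add: H_gen const_0)
  next
    case (Exp_gen j)
    then have j: "j \<in> {1..n}" using x by simp
    have "ad_Ham \<omega> n (U_cls \<omega> n (gE j)) = U_cls \<omega> n 0"
      using j by (intro ad_Ham_cls [OF _ _ j] central) (auto intro!: free_alg_var)
    then show ?thesis by (simp add: Exp_gen const_0)
  next
    case (Expinv_gen j)
    then have j: "j \<in> {1..n}" using x by simp
    have "ad_Ham \<omega> n (U_cls \<omega> n (gEi j)) = U_cls \<omega> n 0"
      using j by (intro ad_Ham_cls [OF _ _ j] central) (auto intro!: free_alg_var)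
    then show ?thesis by (simp add: Expinv_gen const_0)
  qed
  then show ?thesis
    using x by (simp add: U_alg_def U_cls_def U.cls_smult free_alg_var)
qed

text \<open>The values of \<phi> on \<open>gE\<close> and \<open>gEi\<close> are prescribed
  separately because the exponentials are generators in their own right and not series in
  \<open>gH\<close>. The claim about time evolution takes two conjuncts, one for the generator of
  the evolution and one for the evolution itself: the two exponentials are weak sums in different
  algebras, so the second is not a mere substitution of the first.\<close>

theorem mainTheorem5:
  fixes \<omega> :: complex and n :: nat and \<phi> :: "gen ncpoly set \<Rightarrow> gen ncpoly set"
  assumes "\<omega> \<noteq> 0" and "n \<ge> 1"
    and "alg_iso (U_alg \<omega> n) (BU_alg \<omega> n) \<phi>"
    and "\<forall>i \<in> {1..n}. \<phi> (U_cls \<omega> n (gAd i)) = BU_cls \<omega> n (Xd \<omega> i)"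
    and "\<forall>i \<in> {1..n}. \<phi> (U_cls \<omega> n (gA i)) = BU_cls \<omega> n (X i)"
    and "\<forall>i \<in> {1..n}. \<phi> (U_cls \<omega> n (gH i)) = BU_cls \<omega> n (gH i)"
    and "\<forall>i \<in> {1..n}. \<phi> (U_cls \<omega> n (gE i)) = BU_cls \<omega> n (gE i)"
    and "\<forall>i \<in> {1..n}. \<phi> (U_cls \<omega> n (gEi i)) = BU_cls \<omega> n (gEi i)"
    and "\<forall>i \<in> {1..n}. \<phi> (U_cls \<omega> n (gN i)) = BU_cls \<omega> n (M \<omega> i)"
  shows
   "(\<forall>t :: real. \<forall>i \<in> {1..n}.
           transport (U_alg \<omega> n) \<phi> (exp_N_act \<omega> n t) (U_cls \<omega> n (gAd i))
             = exp (\<i> * of_real t) \<odot>\<^bsub>U_alg \<omega> n\<^esub> U_cls \<omega> n (gAd i) \<and>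
           transport (U_alg \<omega> n) \<phi> (exp_N_act \<omega> n t) (U_cls \<omega> n (gA i))
             = exp (- (\<i> * of_real t)) \<odot>\<^bsub>U_alg \<omega> n\<^esub> U_cls \<omega> n (gA i) \<and>
           transport (U_alg \<omega> n) \<phi> (exp_N_act \<omega> n t) (U_cls \<omega> n (gH i)) = U_cls \<omega> n (gH i) \<and>
           transport (U_alg \<omega> n) \<phi> (exp_N_act \<omega> n t) (U_cls \<omega> n (gN i)) = U_cls \<omega> n (gN i)) \<and>
    (\<forall>y \<in> carrier (U_alg \<omega> n).
           transport (U_alg \<omega> n) \<phi> (N_act \<omega> n) y = ad_Ham \<omega> n y) \<and>
    (\<forall>t :: real. \<forall>y \<in> carrier (U_alg \<omega> n).
           transport (U_alg \<omega> n) \<phi> (exp_N_act \<omega> n t) y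
             = op_exp (U_alg \<omega> n) (\<lambda>z. (\<i> * of_real t) \<odot>\<^bsub>U_alg \<omega> n\<^esub> ad_Ham \<omega> n z) y)"
proof -
  note defs = U_alg_def BU_alg_def U_cls_def BU_cls_def
  note iso = assms(3)
  have \<phi>_gen: "\<phi> (U_cls \<omega> n (var x)) = BU_cls \<omega> n (diagonal_gen \<omega> x)" if "x \<in> gens n" for x
    using that assms by (cases x) auto
  have gen_closed: "U_cls \<omega> n (var x) \<in> carrier (U_alg \<omega> n)" if "x \<in> gens n" for x
    using that by (auto simp: defs intro!: U.cls_closed free_alg_var)
  have smult_closed: "c \<odot>\<^bsub>U_alg \<omega> n\<^esub> y \<in> carrier (U_alg \<omega> n)" if "y \<in> carrier (U_alg \<omega> n)" for c y
    using that by (simp add: U_alg_def U.smult_closed)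
  have \<phi>_closed: "\<phi> y \<in> carrier (BU_alg \<omega> n)" if "y \<in> carrier (U_alg \<omega> n)" for y
    using that iso by (auto simp: alg_iso_def ring_hom_closed)
  have \<phi>_smult: "\<phi> (c \<odot>\<^bsub>U_alg \<omega> n\<^esub> y) = c \<odot>\<^bsub>BU_alg \<omega> n\<^esub> \<phi> y" if "y \<in> carrier (U_alg \<omega> n)" for c y
    using that iso by (simp add: alg_iso_def)
  have \<phi>_inv: "inv_into (carrier (U_alg \<omega> n)) \<phi> (\<phi> y) = y" if "y \<in> carrier (U_alg \<omega> n)" for y
    using that iso by (simp add: alg_iso_def bij_betw_def)
  have inv_\<phi>: "\<phi> (inv_into (carrier (U_alg \<omega> n)) \<phi> y) = y" if "y \<in> carrier (BU_alg \<omega> n)" for y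
    using that iso by (simp add: alg_iso_def bij_betw_def f_inv_into_f)
  \<comment> \<open>An eigenvector equation at the image of a generator is pulled back along \<phi>.
    The operator \<open>T\<close> is left arbitrary so that this serves both the action and its
    exponential.\<close>
  have eigen: "transport (U_alg \<omega> n) \<phi> T (U_cls \<omega> n (var x)) = c \<odot>\<^bsub>U_alg \<omega> n\<^esub> U_cls \<omega> n (var x)"
    if "x \<in> gens n" "T (BU_cls \<omega> n (diagonal_gen \<omega> x)) = c \<odot>\<^bsub>BU_alg \<omega> n\<^esub> BU_cls \<omega> n (diagonal_gen \<omega> x)"
    for x T c
  proof -
    have "T (\<phi> (U_cls \<omega> n (var x))) = \<phi> (c \<odot>\<^bsub>U_alg \<omega> n\<^esub> U_cls \<omega> n (var x))"
      using that by (simp add: \<phi>_gen \<phi>_smult gen_closed)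
    then show ?thesis
      using that by (simp add: transport_def \<phi>_inv smult_closed gen_closed)
  qed
  have exp_gen: "transport (U_alg \<omega> n) \<phi> (exp_N_act \<omega> n t) (U_cls \<omega> n (var x)) =
      exp (\<i> * of_real t * of_int (gen_weight x)) \<odot>\<^bsub>U_alg \<omega> n\<^esub> U_cls \<omega> n (var x)"
    if "x \<in> gens n" for x t
    using that
    by (intro eigen) (simp_all add: exp_N_act_def N_act_eq_euler defs BU.op_exp_euler_homogeneous
        diagonal_gen_closed homogeneous_diagonal_gen)
  have one: "1 \<odot>\<^bsub>U_alg \<omega> n\<^esub> U_cls \<omega> n (var x) = U_cls \<omega> n (var x)" if "x \<in> gens n" for x
    using that by (simp add: defs U.cls_smult free_alg_var const_1)

  \<comment> \<open>The transported action and the commutator with the Hamiltonian are derivations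
    of the same algebra, and each generator is an eigenvector of both with its weight as
    eigenvalue.\<close>
  have "derivation (U_alg \<omega> n) (transport (U_alg \<omega> n) \<phi> (N_act \<omega> n))"
    using iso BU.derivation_euler unfolding N_act_eq_euler U_alg_def BU_alg_def
    by (rule U.derivation_transport)
  moreover have "transport (U_alg \<omega> n) \<phi> (N_act \<omega> n) (U_cls \<omega> n (var x)) =
      ad_Ham \<omega> n (U_cls \<omega> n (var x))" if "x \<in> gens n" for x
    unfolding ad_Ham_gen [OF that] using that
    by (intro eigen) (simp_all add: N_act_eq_euler defs BU.euler_homogeneous
        diagonal_gen_closed homogeneous_diagonal_gen)
  ultimately have N_act: "transport (U_alg \<omega> n) \<phi> (N_act \<omega> n) y = ad_Ham \<omega> n y"
    if "y \<in> carrier (U_alg \<omega> n)" for y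
    using U.derivation_eqI derivation_ad_Ham that unfolding defs by blast
  have ad_closed: "ad_Ham \<omega> n y \<in> carrier (U_alg \<omega> n)" if "y \<in> carrier (U_alg \<omega> n)" for y
    using that derivation_ad_Ham [of \<omega> n] unfolding derivation_def by blast
  \<comment> \<open>The intertwining relation behind the comparison of exponentials. Cancelling
    \<phi> against its inverse requires the value of the action to lie in the carrier.\<close>
  have \<phi>_ad: "\<phi> (ad_Ham \<omega> n y) = N_act \<omega> n (\<phi> y)" if "y \<in> carrier (U_alg \<omega> n)" for y
  proof -
    have "N_act \<omega> n (\<phi> y) \<in> carrier (BU_alg \<omega> n)"
      using BU.derivation_euler [of n \<omega>] \<phi>_closed [OF that]
      unfolding derivation_def N_act_eq_euler BU_alg_def by blast
    then show ?thesis
      using N_act [OF that] inv_\<phi> unfolding transport_def by metis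
  qed
  have exp_ad: "transport (U_alg \<omega> n) \<phi> (exp_N_act \<omega> n t) y =
      op_exp (U_alg \<omega> n) (\<lambda>z. (\<i> * of_real t) \<odot>\<^bsub>U_alg \<omega> n\<^esub> ad_Ham \<omega> n z) y"
    if y: "y \<in> carrier (U_alg \<omega> n)" for t y
  proof -
    obtain p where p: "p \<in> carrier (free_alg (gens n))" "\<phi> y = BU_cls \<omega> n p"
      using \<phi>_closed [OF y] by (auto simp: defs BU.carrier_P)
    \<comment> \<open>The exponential on the unbraided side is evaluated in the braided algebra,
      where a representative \<open>p\<close> of the image of \<open>y\<close> makes the weak sum an
      explicit rescaling.\<close>
    have "op_exp (U_alg \<omega> n) (\<lambda>z. (\<i> * of_real t) \<odot>\<^bsub>U_alg \<omega> n\<^esub> ad_Ham \<omega> n z) y =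
        inv_into (carrier (U_alg \<omega> n)) \<phi>
          (BU_cls \<omega> n (rescale gen_weight (\<lambda>d. exp (\<i> * of_real t * of_int d)) p))"
      unfolding U_alg_def
    proof (rule U.op_exp_transport)
      show "alg_iso (U.P n \<omega>) (BU.P n \<omega>) \<phi>" using iso by (simp add: defs)
      show "y \<in> carrier (U.P n \<omega>)" using y by (simp add: defs)
      show "(\<i> * of_real t) \<odot>\<^bsub>U.P n \<omega>\<^esub> ad_Ham \<omega> n z \<in> carrier (U.P n \<omega>)"
        if "z \<in> carrier (U.P n \<omega>)" for z
        using that ad_closed smult_closed by (simp add: U_alg_def)
      show "\<phi> ((\<i> * of_real t) \<odot>\<^bsub>U.P n \<omega>\<^esub> ad_Ham \<omega> n z) =
          (\<i> * of_real t) \<odot>\<^bsub>BU.P n \<omega>\<^esub> BU.euler n \<omega> (\<phi> z)" if "z \<in> carrier (U.P n \<omega>)" for z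
        using that ad_closed \<phi>_smult \<phi>_ad by (simp add: U_alg_def BU_alg_def N_act_eq_euler)
    qed (use p in \<open>auto simp: BU_cls_def intro!: BU.exp_euler_sums rescale_closed\<close>)
    then show ?thesis
      by (simp add: transport_def exp_N_act_def N_act_eq_euler p(2) BU_alg_def BU_cls_def BU.op_exp_euler p(1))
  qed
  show ?thesis
  proof (intro conjI allI ballI)
    fix t :: real and i assume i: "i \<in> {1..n}"
    show "transport (U_alg \<omega> n) \<phi> (exp_N_act \<omega> n t) (U_cls \<omega> n (gAd i))
        = exp (\<i> * of_real t) \<odot>\<^bsub>U_alg \<omega> n\<^esub> U_cls \<omega> n (gAd i)"
      using exp_gen [of "Ad_gen i" t] i by simp
    show "transport (U_alg \<omega> n) \<phi> (exp_N_act \<omega> n t) (U_cls \<omega> n (gA i))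
        = exp (- (\<i> * of_real t)) \<odot>\<^bsub>U_alg \<omega> n\<^esub> U_cls \<omega> n (gA i)"
      using exp_gen [of "A_gen i" t] i by simp
    show "transport (U_alg \<omega> n) \<phi> (exp_N_act \<omega> n t) (U_cls \<omega> n (gH i)) = U_cls \<omega> n (gH i)"
      using exp_gen [of "H_gen i" t] one [of "H_gen i"] i by simp
    show "transport (U_alg \<omega> n) \<phi> (exp_N_act \<omega> n t) (U_cls \<omega> n (gN i)) = U_cls \<omega> n (gN i)"
      using exp_gen [of "N_gen i" t] one [of "N_gen i"] i by simp
  qed (rule N_act exp_ad; assumption)+
qed

end
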